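(* Let $d\ge 2$, let $u_1,\ldots,u_{d+1}$ be elements of the free group $F_d$ on $x_1,\ldots,x_d$, let $m_1,\ldots,m_{d+1}\ge 1$ be integers, and let $G$ be the group given by the finite presentation $$P=\langle x_1,\ldots,x_d \mid u_1^{m_1},\ldots,u_{d+1}^{m_{d+1}}\rangle .$$ Let $I=\{1,\ldots,d+1\}$. For $i\in I$ let $G_i$ be the group given by the presentation obtained from $P$ by removing the relator $u_i^{m_i}$. Let $J$ be the set of those $j\in I$ such that $G_j$ has finite abelianisation, and let $l=|J|$. Suppose that $G$ has non-trivial finite abelianisation. Then: (1) The commutator subgroup $[G,G]$ of $G$ has deficiency greater than one if $$d-l-\sum_{i\in I\setminus J}\frac{1}{m_i}>1 .$$ (2) If for some $j\in J$ the image of $u_j^{m_j}$ in $G_j$ is contained in the commutator subgroup $[G_j,G_j]$ of $G_j$, then the commutator subgroup $[G,G]$ of $G$ has deficiency greater than one if $$d-\sum_{i\in I,\ i\neq j}\frac{1}{m_i}-\frac{1}{k}>1,$$ where $k$ is the order of the image of $u_j$ in the abelianisation of $G_j$.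
   Context: The deficiency of a finite presentation is the number of generators minus the number of relators. The deficiency of a finitely presented group is the supremum of the deficiencies of all finite presentations defining that group. The abelianisation of a group $G$ is $G/[G,G]$. *)

theory Defs
  imports "HOL-Algebra.Generated_Groups" "HOL-Algebra.Multiplicative_Group" "HOL-Library.Extended_Real"
begin

section \<open>Free groups\<close>

text \<open>A letter \<open>(x, True)\<close> stands for the generator \<open>x\<close>, and \<open>(x, False)\<close> for its inverse.
  Elements of the free group are the reduced words.\<close>

type_synonym 'a word = "('a \<times> bool) list"

fun inv_letter :: "'a \<times> bool \<Rightarrow> 'a \<times> bool" where
  "inv_letter (x, b) = (x, \<not> b)"

definition reduced :: "'a word \<Rightarrow> bool" where
  "reduced w \<longleftrightarrow> successively (\<lambda>a b. b \<noteq> inv_letter a) w"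

fun cons_reduce :: "'a \<times> bool \<Rightarrow> 'a word \<Rightarrow> 'a word" where
  "cons_reduce a [] = [a]"
| "cons_reduce a (b # w) = (if b = inv_letter a then w else a # b # w)"

definition reduce :: "'a word \<Rightarrow> 'a word" where
  "reduce w = foldr cons_reduce w []"

definition free_group :: "'a set \<Rightarrow> 'a word monoid" where
  "free_group X =
     \<lparr>carrier = {w. fst ` set w \<subseteq> X \<and> reduced w},
      monoid.mult = (\<lambda>v w. reduce (v @ w)), one = []\<rparr>"

lemma inv_letter_inv_letter [simp]: "inv_letter (inv_letter a) = a"
  by (cases a) auto

lemma fst_inv_letter [simp]: "fst (inv_letter a) = fst a"
  by (cases a) auto

lemma inv_letter_neq [simp]: "inv_letter a \<noteq> a" "a \<noteq> inv_letter a"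
  by (cases a; auto)+

lemma reduced_cons_reduce: "reduced w \<Longrightarrow> reduced (cons_reduce a w)"
  by (cases w) (auto simp: reduced_def successively_Cons)

lemma cons_reduce_reduced: "reduced (a # w) \<Longrightarrow> cons_reduce a w = a # w"
  by (cases w) (auto simp: reduced_def)

lemma cons_reduce_inv: "reduced w \<Longrightarrow> cons_reduce (inv_letter a) (cons_reduce a w) = w"
  by (cases w; cases "tl w") (auto simp: reduced_def)

lemma reduced_foldr: "reduced w \<Longrightarrow> reduced (foldr cons_reduce v w)"
  by (induction v) (auto intro: reduced_cons_reduce)

lemma reduced_reduce: "reduced (reduce w)"
  unfolding reduce_def by (rule reduced_foldr) (simp add: reduced_def)

lemma reduce_reduced: "reduced w \<Longrightarrow> reduce w = w"
proof (induction w)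
  case Nil
  then show ?case by (simp add: reduce_def)
next
  case (Cons a w)
  have "reduced w" using Cons.prems by (auto simp: reduced_def successively_Cons)
  then show ?case using Cons cons_reduce_reduced[of a w] by (simp add: reduce_def)
qed

lemma reduce_append: "reduce (v @ w) = foldr cons_reduce v (reduce w)"
  by (simp add: reduce_def)

lemma foldr_cons_reduce_cons_reduce:
  assumes "reduced w"
  shows "foldr cons_reduce (cons_reduce a v) w = cons_reduce a (foldr cons_reduce v w)"
proof (cases v)
  case (Cons b v')
  have "reduced (foldr cons_reduce v' w)" using assms by (rule reduced_foldr)
  then show ?thesis using Cons cons_reduce_inv[of "foldr cons_reduce v' w" "inv_letter a"] by auto
qed auto

lemma foldr_cons_reduce_foldr:
  "reduced w \<Longrightarrow>
    foldr cons_reduce (foldr cons_reduce u v) w = foldr cons_reduce u (foldr cons_reduce v w)"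
  by (induction u) (auto simp: foldr_cons_reduce_cons_reduce)

lemma fst_set_cons_reduce: "fst ` set (cons_reduce a w) \<subseteq> insert (fst a) (fst ` set w)"
  by (cases w) auto

lemma fst_set_foldr: "fst ` set (foldr cons_reduce v w) \<subseteq> fst ` set v \<union> fst ` set w"
proof (induction v)
  case (Cons a v)
  have "fst ` set (foldr cons_reduce (a # v) w) \<subseteq>
      insert (fst a) (fst ` set (foldr cons_reduce v w))"
    by (simp add: fst_set_cons_reduce)
  also have "\<dots> \<subseteq> insert (fst a) (fst ` set v \<union> fst ` set w)"
    using Cons.IH by (rule insert_mono)
  finally show ?case by simp
qed auto

lemma fst_set_reduce: "fst ` set (reduce w) \<subseteq> fst ` set w"
  using fst_set_foldr[of w "[]"] by (simp add: reduce_def)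

lemma foldr_cons_reduce_inverse:
  "reduced w \<Longrightarrow> foldr cons_reduce (rev (map inv_letter v)) (foldr cons_reduce v w) = w"
  by (induction v) (auto simp: cons_reduce_inv reduced_foldr)

lemma group_free_group: "group (free_group X)"
proof (rule groupI)
  fix u v assume "u \<in> carrier (free_group X)" "v \<in> carrier (free_group X)"
  then have "fst ` set (u @ v) \<subseteq> X" by (auto simp: free_group_def)
  then have "fst ` set (reduce (u @ v)) \<subseteq> X" using fst_set_reduce by (rule order_trans[rotated])
  then show "u \<otimes>\<^bsub>free_group X\<^esub> v \<in> carrier (free_group X)"
    by (simp add: free_group_def reduced_reduce)
next
  show "\<one>\<^bsub>free_group X\<^esub> \<in> carrier (free_group X)"
    by (simp add: free_group_def reduced_def)
next
  fix u v w
  assume "u \<in> carrier (free_group X)" "v \<in> carrier (free_group X)" "w \<in> carrier (free_group X)"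
  then have "reduced w" "reduced v" by (auto simp: free_group_def)
  moreover have "reduced (foldr cons_reduce v w)"
    using \<open>reduced w\<close> by (rule reduced_foldr)
  ultimately show "u \<otimes>\<^bsub>free_group X\<^esub> v \<otimes>\<^bsub>free_group X\<^esub> w =
      u \<otimes>\<^bsub>free_group X\<^esub> (v \<otimes>\<^bsub>free_group X\<^esub> w)"
    by (simp add: free_group_def reduce_append reduce_reduced foldr_cons_reduce_foldr)
next
  fix u assume "u \<in> carrier (free_group X)"
  then show "\<one>\<^bsub>free_group X\<^esub> \<otimes>\<^bsub>free_group X\<^esub> u = u"
    by (simp add: free_group_def reduce_reduced)
next
  fix u assume u: "u \<in> carrier (free_group X)"
  let ?v = "reduce (rev (map inv_letter u))"
  have "fst ` set (rev (map inv_letter u)) \<subseteq> X"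
    using u by (simp add: free_group_def image_image)
  then have "fst ` set ?v \<subseteq> X" using fst_set_reduce by (rule order_trans[rotated])
  then have "?v \<in> carrier (free_group X)"
    by (simp add: free_group_def reduced_reduce)
  moreover have "?v \<otimes>\<^bsub>free_group X\<^esub> u = \<one>\<^bsub>free_group X\<^esub>"
  proof -
    have r: "reduced u" and r0: "reduced ([] :: 'a word)"
      using u by (auto simp: free_group_def reduced_def)
    have "reduce (?v @ u) = foldr cons_reduce (rev (map inv_letter u)) (foldr cons_reduce [] u)"
      using r foldr_cons_reduce_foldr[OF r, of "rev (map inv_letter u)" "[]"]
      unfolding reduce_append reduce_reduced[OF r] by (simp add: reduce_def)
    also have "\<dots> = []"
      using foldr_cons_reduce_inverse[OF r0, of u] reduce_reduced[OF r] by (simp add: reduce_def)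
    finally show ?thesis by (simp add: free_group_def)
  qed
  ultimately show "\<exists>v\<in>carrier (free_group X). v \<otimes>\<^bsub>free_group X\<^esub> u = \<one>\<^bsub>free_group X\<^esub>"
    by blast
qed


section \<open>Presentations and deficiency\<close>

definition normal_closure :: "('a, 'b) monoid_scheme \<Rightarrow> 'a set \<Rightarrow> 'a set" where
  "normal_closure G R = \<Inter>{N. N \<lhd> G \<and> R \<subseteq> N}"

definition presented_group :: "'a set \<Rightarrow> 'a word set \<Rightarrow> 'a word set monoid" where
  "presented_group X R = free_group X Mod normal_closure (free_group X) R"

definition presentation_proj :: "'a set \<Rightarrow> 'a word set \<Rightarrow> 'a word \<Rightarrow> 'a word set" where
  "presentation_proj X R w = normal_closure (free_group X) R #>\<^bsub>free_group X\<^esub> w"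

text \<open>A finite presentation is a number \<open>n\<close> of generators together with a list of relators
  in the free group on \<open>{1..n}\<close>; repetitions and trivial relators are allowed and counted.\<close>

definition finite_presentation_of ::
    "('a, 'b) monoid_scheme \<Rightarrow> nat \<Rightarrow> nat word list \<Rightarrow> bool" where
  "finite_presentation_of G n rs \<longleftrightarrow>
     set rs \<subseteq> carrier (free_group {1..n}) \<and> G \<cong> presented_group {1..n} (set rs)"

text \<open>The value is \<open>-\<infinity>\<close> if \<open>G\<close> is not finitely presented, so that a lower bound
  \<open>deficiency G > c\<close> with real \<open>c\<close> includes the claim that \<open>G\<close> is finitely presented.\<close>

definition deficiency :: "('a, 'b) monoid_scheme \<Rightarrow> ereal" where
  "deficiency G =
     Sup {ereal (real n - real (length rs)) | n rs. finite_presentation_of G n rs}"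


section \<open>Commutator subgroup and abelianisation\<close>

abbreviation commutator_subgroup :: "('a, 'b) monoid_scheme \<Rightarrow> 'a set" where
  "commutator_subgroup G \<equiv> derived G (carrier G)"

definition commutator_group :: "('a, 'b) monoid_scheme \<Rightarrow> ('a, 'b) monoid_scheme" where
  "commutator_group G = G\<lparr>carrier := commutator_subgroup G\<rparr>"

definition abelianisation :: "('a, 'b) monoid_scheme \<Rightarrow> 'a set monoid" where
  "abelianisation G = G Mod commutator_subgroup G"

definition abelianisation_proj :: "('a, 'b) monoid_scheme \<Rightarrow> 'a \<Rightarrow> 'a set" where
  "abelianisation_proj G g = commutator_subgroup G #>\<^bsub>G\<^esub> g"

end

theory Submission
  imports Defs
begin

text \<open>Write \<open>F\<close> for the free group on \<open>d\<close> generators, \<open>Q\<close> for the finite abelianisation of \<open>G\<close>,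
  \<open>n\<close> for its order, \<open>\<rho>\<close> for the projection of \<open>F\<close> onto \<open>Q\<close> and \<open>o\<^sub>i\<close> for the order of \<open>\<rho> u\<^sub>i\<close>. The
  theorem follows from one estimate and two computations of orders.

  The estimate is \<open>def [G,G] \<ge> 1 + n (d - 1 - \<Sum>\<^sub>i 1/o\<^sub>i)\<close> (lemma \<open>deficiency_kernel_ge\<close>), so that the
  commutator subgroup has deficiency greater than one as soon as \<open>d - \<Sum>\<^sub>i 1/o\<^sub>i > 1\<close>. Topologically,
  \<open>[G,G]\<close> is the fundamental group of the \<open>n\<close>-sheeted cover of the presentation complex of \<open>G\<close>. The
  cover has \<open>n\<close> vertices and \<open>n d\<close> edges, and making a path from the base point to each other vertex
  trivial costs \<open>n - 1\<close> relators. The loop \<open>u\<^sub>i ^ m\<^sub>i\<close> has \<open>n\<close> lifts, but lifts whose starting points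
  lie in one left coset of \<open>\<langle>\<rho> u\<^sub>i\<rangle>\<close> traverse the same closed path from different starting points,
  hence are conjugate; only \<open>n / o\<^sub>i\<close> of them are needed. The algebraic form is Reidemeister's
  rewriting process: a word is rewritten as the sequence of edges that it traverses in the cover,
  and this is a crossed homomorphism from \<open>F\<close> to the free group on the edges.

  The orders come from the following fact (lemma \<open>ord_abelian_image_ge\<close>): if a presentation has
  infinite abelianisation, and adding the relator \<open>u ^ m\<close> makes it finite, then \<open>u\<close> has order at
  least \<open>m\<close> in the finite abelianisation. For the first assertion this gives \<open>o\<^sub>i \<ge> m\<^sub>i\<close> for \<open>i \<notin> J\<close>,
  and \<open>o\<^sub>i \<ge> 1\<close> is enough for \<open>i \<in> J\<close>. For the second, the relator \<open>u\<^sub>j ^ m\<^sub>j\<close> dies in the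
  abelianisation of \<open>H j\<close>, so that this group is a quotient of \<open>Q\<close> and orders may be bounded there: \<open>o\<^sub>j \<ge> k\<close>, and for
  \<open>i \<noteq> j\<close> the fact applies again, since dropping \<open>u\<^sub>i ^ m\<^sub>i\<close> as well leaves \<open>d - 1\<close> relators on \<open>d\<close>
  generators, and fewer relators than generators force an infinite abelianisation.\<close>

section \<open>Homomorphisms and crossed homomorphisms on free groups\<close>

lemma carrier_free_group: "w \<in> carrier (free_group X) \<longleftrightarrow> fst ` set w \<subseteq> X \<and> reduced w"
  by (simp add: free_group_def)

lemma one_free_group: "\<one>\<^bsub>free_group X\<^esub> = []"
  by (simp add: free_group_def)

lemma mult_free_group:
  "w \<in> carrier (free_group X) \<Longrightarrow> v \<otimes>\<^bsub>free_group X\<^esub> w = foldr cons_reduce v w"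
  by (simp add: free_group_def reduce_append reduce_reduced)

lemma letter_in_free_group: "fst a \<in> X \<Longrightarrow> [a] \<in> carrier (free_group X)"
  by (simp add: free_group_def reduced_def)

lemma Cons_in_free_groupD:
  assumes "a # w \<in> carrier (free_group X)"
  shows "fst a \<in> X" "w \<in> carrier (free_group X)" "a # w = [a] \<otimes>\<^bsub>free_group X\<^esub> w"
proof -
  show "fst a \<in> X" and w: "w \<in> carrier (free_group X)"
    using assms by (auto simp: carrier_free_group reduced_def successively_Cons)
  have "cons_reduce a w = a # w"
    using assms by (intro cons_reduce_reduced) (simp add: carrier_free_group)
  then show "a # w = [a] \<otimes>\<^bsub>free_group X\<^esub> w" using w by (simp add: mult_free_group)
qed

lemma inv_letter_free_group:
  assumes "x \<in> X"
  shows "inv\<^bsub>free_group X\<^esub> [(x, True)] = [(x, False)]"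
proof -
  interpret F: group "free_group X" by (rule group_free_group)
  have "[(x, False)] \<otimes>\<^bsub>free_group X\<^esub> [(x, True)] = \<one>\<^bsub>free_group X\<^esub>"
    using assms by (simp add: mult_free_group letter_in_free_group one_free_group)
  then show ?thesis using assms by (intro F.inv_equality) (auto intro: letter_in_free_group)
qed

lemma free_group_hom_eq:
  assumes "group B" "f \<in> hom (free_group X) B" "g \<in> hom (free_group X) B"
    and fg: "\<And>x. x \<in> X \<Longrightarrow> f [(x, True)] = g [(x, True)]"
    and "w \<in> carrier (free_group X)"
  shows "f w = g w"
proof -
  interpret f: group_hom "free_group X" B f
    using assms group_free_group by (auto simp: group_hom_def group_hom_axioms_def)
  interpret g: group_hom "free_group X" B g
    using assms group_free_group by (auto simp: group_hom_def group_hom_axioms_def)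
  have letter: "f [a] = g [a]" if "fst a \<in> X" for a
  proof (cases a)
    case (Pair x b)
    have x: "x \<in> X" using that Pair by simp
    have "f [(x, False)] = g [(x, False)]"
      unfolding inv_letter_free_group[OF x, symmetric]
      using x fg by (simp add: letter_in_free_group)
    then show ?thesis using Pair x fg by (cases b) auto
  qed
  show ?thesis using \<open>w \<in> carrier (free_group X)\<close>
  proof (induction w)
    case Nil
    then show ?case using f.hom_one g.hom_one by (simp add: one_free_group)
  next
    case (Cons a w)
    note D = Cons_in_free_groupD[OF Cons.prems]
    have "f ([a] \<otimes>\<^bsub>free_group X\<^esub> w) = g ([a] \<otimes>\<^bsub>free_group X\<^esub> w)"
      using D letter[of a] Cons.IH by (simp add: letter_in_free_group)
    then show ?case using D(3) by simp
  qed
qed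

text \<open>The product of the labels \<open>e\<close> met by an automaton with transition function \<open>s\<close> that starts in
  state \<open>q\<close> and reads a word.\<close>

primrec transport :: "('b, 'm) monoid_scheme \<Rightarrow> ('q \<Rightarrow> 'l \<Rightarrow> 'q) \<Rightarrow> ('q \<Rightarrow> 'l \<Rightarrow> 'b) \<Rightarrow> 'q \<Rightarrow> 'l list \<Rightarrow> 'b"
  where
    "transport B s e q [] = \<one>\<^bsub>B\<^esub>"
  | "transport B s e q (a # w) = e q a \<otimes>\<^bsub>B\<^esub> transport B s e (s q a) w"

text \<open>Crossed homomorphisms from a free group exist with arbitrary values on the generators,
  where the free group acts through \<open>\<rho>\<close> on the states \<open>q\<close>. The value on an inverse letter is forced:
  the edge labelled \<open>x\<close> is traversed backwards, so its label belongs to the state reached, not to the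
  state left.\<close>

lemma free_group_cocycle:
  fixes Q :: "('q, 'n) monoid_scheme" and B :: "('b, 'm) monoid_scheme" and g :: "'q \<Rightarrow> 'x \<Rightarrow> 'b"
  assumes B: "group B" and Q: "group Q" and \<rho>: "\<rho> \<in> hom (free_group X) Q"
    and g: "\<And>q x. q \<in> carrier Q \<Longrightarrow> x \<in> X \<Longrightarrow> g q x \<in> carrier B"
  obtains \<tau> where
    "\<And>q w. q \<in> carrier Q \<Longrightarrow> w \<in> carrier (free_group X) \<Longrightarrow> \<tau> q w \<in> carrier B"
    "\<And>q v w. q \<in> carrier Q \<Longrightarrow> v \<in> carrier (free_group X) \<Longrightarrow> w \<in> carrier (free_group X) \<Longrightarrow>
       \<tau> q (v \<otimes>\<^bsub>free_group X\<^esub> w) = \<tau> q v \<otimes>\<^bsub>B\<^esub> \<tau> (q \<otimes>\<^bsub>Q\<^esub> \<rho> v) w"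
    "\<And>q x. q \<in> carrier Q \<Longrightarrow> x \<in> X \<Longrightarrow> \<tau> q [(x, True)] = g q x"
proof -
  interpret B: group B by fact
  interpret \<rho>: group_hom "free_group X" Q \<rho>
    using Q \<rho> group_free_group by (auto simp: group_hom_def group_hom_axioms_def)
  define s where "s q a = q \<otimes>\<^bsub>Q\<^esub> \<rho> [a]" for q a
  define e where "e q a = (if snd a then g q (fst a) else inv\<^bsub>B\<^esub> g (s q a) (fst a))" for q a
  define \<tau> where "\<tau> = transport B s e"
  have \<tau>_Nil: "\<tau> q [] = \<one>\<^bsub>B\<^esub>" and \<tau>_Cons: "\<tau> q (a # w) = e q a \<otimes>\<^bsub>B\<^esub> \<tau> (s q a) w" for q a w
    by (simp_all add: \<tau>_def)
  have \<rho>_inv: "\<rho> [(x, False)] = inv\<^bsub>Q\<^esub> \<rho> [(x, True)]" if "x \<in> X" for x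
    using that by (simp add: letter_in_free_group flip: inv_letter_free_group)
  have s: "s q a \<in> carrier Q" and e: "e q a \<in> carrier B"
    if "q \<in> carrier Q" "fst a \<in> X" for q a
    using that g letter_in_free_group[of a X] by (auto simp: s_def e_def)
  have s_inv: "s (s q a) (inv_letter a) = q" if "q \<in> carrier Q" "fst a \<in> X" for q a
    using that letter_in_free_group[of a X]
    by (cases a; cases "snd a") (auto simp: s_def \<rho>_inv letter_in_free_group \<rho>.H.m_assoc)
  have e_inv: "e q a \<otimes>\<^bsub>B\<^esub> e (s q a) (inv_letter a) = \<one>\<^bsub>B\<^esub>"
    if "q \<in> carrier Q" "fst a \<in> X" for q a
    using that s_inv[OF that] s[OF that] g by (cases a; cases "snd a") (auto simp: e_def)
  have closed: "\<tau> q w \<in> carrier B" if "q \<in> carrier Q" "fst ` set w \<subseteq> X" for q w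
    using that by (induction w arbitrary: q) (auto simp: \<tau>_Nil \<tau>_Cons s e)
  \<comment> \<open>Cancellation does not change the product, so that it makes sense on reduced words.\<close>
  have step: "\<tau> q (cons_reduce a w) = e q a \<otimes>\<^bsub>B\<^esub> \<tau> (s q a) w"
    if "q \<in> carrier Q" "fst a \<in> X" "fst ` set w \<subseteq> X" for q a w
  proof (cases "\<exists>w'. w = inv_letter a # w'")
    case True
    then obtain w' where w': "w = inv_letter a # w'" by blast
    have c: "\<tau> q w' \<in> carrier B" using that w' by (intro closed) auto
    have "e q a \<otimes>\<^bsub>B\<^esub> \<tau> (s q a) w = e q a \<otimes>\<^bsub>B\<^esub> (e (s q a) (inv_letter a) \<otimes>\<^bsub>B\<^esub> \<tau> q w')"
      using w' s_inv[OF that(1,2)] by (simp add: \<tau>_Cons)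
    also have "\<dots> = \<tau> q w'"
      using that c e_inv[OF that(1,2)] by (simp add: B.m_assoc[symmetric] e s)
    finally show ?thesis using w' by simp
  next
    case False
    then have "cons_reduce a w = a # w" by (cases w) auto
    then show ?thesis by (simp add: \<tau>_Cons)
  qed
  have fold: "\<tau> q (foldr cons_reduce v w) = \<tau> q v \<otimes>\<^bsub>B\<^esub> \<tau> (foldl s q v) w"
    if "q \<in> carrier Q" "fst ` set v \<subseteq> X" "fst ` set w \<subseteq> X" for q v w
    using that
  proof (induction v arbitrary: q)
    case Nil
    then show ?case using closed[of q w] by (simp add: \<tau>_Nil)
  next
    case (Cons a v)
    have "fst ` set (foldr cons_reduce v w) \<subseteq> X"
      using Cons.prems fst_set_foldr[of v w] by (meson Un_least order_trans set_subset_Cons image_mono)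
    then have "\<tau> q (foldr cons_reduce (a # v) w)
        = e q a \<otimes>\<^bsub>B\<^esub> (\<tau> (s q a) v \<otimes>\<^bsub>B\<^esub> \<tau> (foldl s (s q a) v) w)"
      using Cons by (simp add: step s)
    moreover have "foldl s p v \<in> carrier Q" if "p \<in> carrier Q" for p
      using that Cons.prems(2) by (induction v arbitrary: p) (auto simp: s)
    ultimately show ?case
      using Cons.prems by (simp add: \<tau>_Cons B.m_assoc closed s e)
  qed
  have fold_\<rho>: "foldl s q v = q \<otimes>\<^bsub>Q\<^esub> \<rho> v" if "q \<in> carrier Q" "v \<in> carrier (free_group X)" for q v
    using that
  proof (induction v arbitrary: q)
    case Nil
    then show ?case using \<rho>.hom_one by (simp add: one_free_group)
  next
    case (Cons a v)
    note D = Cons_in_free_groupD[OF Cons.prems(2)]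
    have "foldl s q (a # v) = s q a \<otimes>\<^bsub>Q\<^esub> \<rho> v"
      using Cons.IH[OF s D(2)] Cons.prems(1) D(1) by simp
    also have "\<dots> = q \<otimes>\<^bsub>Q\<^esub> \<rho> ([a] \<otimes>\<^bsub>free_group X\<^esub> v)"
      using Cons.prems(1) D(1,2) by (simp add: s_def letter_in_free_group \<rho>.H.m_assoc)
    finally have "foldl s q (a # v) = q \<otimes>\<^bsub>Q\<^esub> \<rho> ([a] \<otimes>\<^bsub>free_group X\<^esub> v)" .
    then show ?case using D(3) by simp
  qed
  show thesis
  proof
    show "\<tau> q w \<in> carrier B" if "q \<in> carrier Q" "w \<in> carrier (free_group X)" for q w
      using that closed by (simp add: carrier_free_group)
    show "\<tau> q (v \<otimes>\<^bsub>free_group X\<^esub> w) = \<tau> q v \<otimes>\<^bsub>B\<^esub> \<tau> (q \<otimes>\<^bsub>Q\<^esub> \<rho> v) w"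
      if "q \<in> carrier Q" "v \<in> carrier (free_group X)" "w \<in> carrier (free_group X)" for q v w
      using that fold[of q v w] fold_\<rho>[of q v] by (simp add: mult_free_group) (simp add: carrier_free_group)
    show "\<tau> q [(x, True)] = g q x" if "q \<in> carrier Q" "x \<in> X" for q x
      using that g by (simp add: \<tau>_Cons \<tau>_Nil e_def)
  qed
qed

text \<open>The universal property is the case of a crossed homomorphism with trivial action. Since the
  trivial homomorphism may take values in any group, \<open>B\<close> itself serves as the group of states.\<close>

lemma free_group_lift:
  assumes B: "group B" and f: "\<And>x. x \<in> X \<Longrightarrow> f x \<in> carrier B"
  obtains h where "h \<in> hom (free_group X) B" "\<And>x. x \<in> X \<Longrightarrow> h [(x, True)] = f x"
proof -
  interpret B: group B by fact
  have triv: "(\<lambda>_. \<one>\<^bsub>B\<^esub>) \<in> hom (free_group X) B" by (simp add: hom_def)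
  obtain \<tau> where \<tau>:
    "\<And>q w. q \<in> carrier B \<Longrightarrow> w \<in> carrier (free_group X) \<Longrightarrow> \<tau> q w \<in> carrier B"
    "\<And>q v w. q \<in> carrier B \<Longrightarrow> v \<in> carrier (free_group X) \<Longrightarrow> w \<in> carrier (free_group X) \<Longrightarrow>
       \<tau> q (v \<otimes>\<^bsub>free_group X\<^esub> w) = \<tau> q v \<otimes>\<^bsub>B\<^esub> \<tau> (q \<otimes>\<^bsub>B\<^esub> \<one>\<^bsub>B\<^esub>) w"
    "\<And>q x. q \<in> carrier B \<Longrightarrow> x \<in> X \<Longrightarrow> \<tau> q [(x, True)] = f x"
    by (rule free_group_cocycle[OF B B triv, of "\<lambda>_. f"]) (use f in blast)+
  show thesis
  proof
    show "\<tau> \<one>\<^bsub>B\<^esub> \<in> hom (free_group X) B" using \<tau>(1,2) by (auto simp: hom_def)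
    show "\<And>x. x \<in> X \<Longrightarrow> \<tau> \<one>\<^bsub>B\<^esub> [(x, True)] = f x" using \<tau>(3) by simp
  qed
qed

section \<open>Presented groups\<close>

lemma (in group) normal_closure_properties:
  assumes "R \<subseteq> carrier G"
  shows normal_normal_closure: "normal_closure G R \<lhd> G"
    and subset_normal_closure: "R \<subseteq> normal_closure G R"
proof -
  have ne: "{N. N \<lhd> G \<and> R \<subseteq> N} \<noteq> {}" using normal_self assms by blast
  show "normal_closure G R \<lhd> G"
    unfolding normal_closure_def
  proof (rule normal_invI)
    show "subgroup (\<Inter>{N. N \<lhd> G \<and> R \<subseteq> N}) G"
      using ne by (intro subgroups_Inter) (auto dest: normal_imp_subgroup)
    show "\<And>x h. x \<in> carrier G \<Longrightarrow> h \<in> \<Inter>{N. N \<lhd> G \<and> R \<subseteq> N} \<Longrightarrow> x \<otimes> h \<otimes> inv x \<in> \<Inter>{N. N \<lhd> G \<and> R \<subseteq> N}"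
      by (auto intro: normal.inv_op_closed2)
  qed
  show "R \<subseteq> normal_closure G R" by (auto simp: normal_closure_def)
qed

lemma normal_closure_minimal: "N \<lhd> G \<Longrightarrow> R \<subseteq> N \<Longrightarrow> normal_closure G R \<subseteq> N"
  by (auto simp: normal_closure_def)

lemma (in normal) rcos_eq_self_iff: "x \<in> carrier G \<Longrightarrow> H #> x = H \<longleftrightarrow> x \<in> H"
  using coset_join1[OF _ _ is_subgroup] coset_join2[OF _ is_subgroup] by blast

lemma
  assumes R: "R \<subseteq> carrier (free_group X)"
  shows group_presented_group: "group (presented_group X R)"
    and presentation_proj_hom: "presentation_proj X R \<in> hom (free_group X) (presented_group X R)"
    and presentation_proj_surj:
      "presentation_proj X R ` carrier (free_group X) = carrier (presented_group X R)"
    and presentation_proj_eq_one_iff: "\<And>w. w \<in> carrier (free_group X) \<Longrightarrow>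
      presentation_proj X R w = \<one>\<^bsub>presented_group X R\<^esub> \<longleftrightarrow> w \<in> normal_closure (free_group X) R"
proof -
  interpret F: group "free_group X" by (rule group_free_group)
  interpret N: normal "normal_closure (free_group X) R" "free_group X"
    using R by (rule F.normal_normal_closure)
  show "group (presented_group X R)"
    unfolding presented_group_def by (rule N.factorgroup_is_group)
  show "presentation_proj X R \<in> hom (free_group X) (presented_group X R)"
    using N.r_coset_hom_Mod unfolding presented_group_def presentation_proj_def[abs_def] by simp
  show "presentation_proj X R ` carrier (free_group X) = carrier (presented_group X R)"
    by (auto simp: presented_group_def carrier_FactGroup presentation_proj_def)
  show "presentation_proj X R w = \<one>\<^bsub>presented_group X R\<^esub> \<longleftrightarrow> w \<in> normal_closure (free_group X) R"
    if "w \<in> carrier (free_group X)" for w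
    using N.rcos_eq_self_iff[OF that] by (simp add: presentation_proj_def presented_group_def)
qed

section \<open>Cosets of cyclic subgroups and powers under crossed homomorphisms\<close>

lemma (in group) eq_inv_if_mult_eq_one:
  "x \<otimes> y = \<one> \<Longrightarrow> x \<in> carrier G \<Longrightarrow> y \<in> carrier G \<Longrightarrow> y = inv x"
  using inv_comm inv_equality by metis

text \<open>Left cosets are wanted since a word moves the states of the cover by multiplication on the right;
  they are obtained as the inverses of right cosets.\<close>

lemma (in group) left_coset_representatives:
  assumes fin: "finite (carrier G)" and a: "a \<in> carrier G"
  obtains C where "C \<subseteq> carrier G" "card C * ord a = order G"
    "\<And>q. q \<in> carrier G \<Longrightarrow> \<exists>c\<in>C. \<exists>k::nat. q = c \<otimes> a [^] k"
proof -
  define A where "A = generate G {a}"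
  have A: "subgroup A G" unfolding A_def using a by (intro generate_is_subgroup) simp
  define rep where "rep K = (SOME x. x \<in> K)" for K :: "'a set"
  have rep: "rep K \<in> K" if "K \<in> rcosets A" for K
    unfolding rep_def using subgroup.rcosets_non_empty[OF A that] by (simp add: some_in_eq)
  have rep_carrier: "rep K \<in> carrier G" if "K \<in> rcosets A" for K
    using rep[OF that] that subgroup.rcosets_carrier[OF A is_group] by blast
  define C where "C = (\<lambda>K. inv (rep K)) ` (rcosets A)"
  have "inj_on (\<lambda>K. inv (rep K)) (rcosets A)"
  proof (rule inj_onI)
    fix K L assume KL: "K \<in> rcosets A" "L \<in> rcosets A" "inv (rep K) = inv (rep L)"
    then have "rep K = rep L" using rep_carrier inv_inv by metis
    then have "K \<inter> L \<noteq> {}" using rep KL by (metis disjoint_iff)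
    then show "K = L" using rcos_disjoint[OF A] KL by (auto simp: pairwise_def disjnt_def)
  qed
  then have "card C = card (rcosets A)" unfolding C_def by (rule card_image)
  then have "card C * ord a = order G"
    using lagrange[OF A] a by (simp add: generate_pow_card A_def)
  moreover have "C \<subseteq> carrier G" using rep_carrier by (auto simp: C_def)
  moreover have "\<exists>c\<in>C. \<exists>k::nat. q = c \<otimes> a [^] k" if q: "q \<in> carrier G" for q
  proof -
    define K where "K = A #> inv q"
    have K: "K \<in> rcosets A" using q A by (auto simp: K_def RCOSETS_def)
    obtain b where b: "b \<in> A" "rep K = b \<otimes> inv q"
      using rep[OF K] by (auto simp: K_def r_coset_def)
    have bc: "b \<in> carrier G" using subgroup.mem_carrier[OF A b(1)] .
    obtain k :: nat where k: "b = a [^] k"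
      using b generate_pow_on_finite_carrier[OF fin a] by (auto simp: A_def)
    have "inv (rep K) \<otimes> b = q"
      unfolding b(2) using bc q by (simp add: inv_mult_group m_assoc)
    then have "q = inv (rep K) \<otimes> a [^] k" unfolding k by simp
    moreover have "inv (rep K) \<in> C" using K by (simp add: C_def)
    ultimately show ?thesis by blast
  qed
  ultimately show thesis using that by blast
qed

text \<open>Reading \<open>u\<close> repeatedly runs around a closed path of the cover. The power \<open>u ^ m\<close> read from two
  states on that path gives two loops that differ by the choice of the starting point. Hence one
  relator serves for all states on the path.\<close>

lemma cocycle_pow_conjugate:
  fixes s m :: nat
  assumes B: "group B" and Q: "group Q" and F: "group F" and \<rho>: "\<rho> \<in> hom F Q"
    and \<tau>_closed: "\<And>q w. q \<in> carrier Q \<Longrightarrow> w \<in> carrier F \<Longrightarrow> \<tau> q w \<in> carrier B"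
    and \<tau>_mult: "\<And>q v w. q \<in> carrier Q \<Longrightarrow> v \<in> carrier F \<Longrightarrow> w \<in> carrier F \<Longrightarrow>
       \<tau> q (v \<otimes>\<^bsub>F\<^esub> w) = \<tau> q v \<otimes>\<^bsub>B\<^esub> \<tau> (q \<otimes>\<^bsub>Q\<^esub> \<rho> v) w"
    and c: "c \<in> carrier Q" and u: "u \<in> carrier F" and um: "\<rho> (u [^]\<^bsub>F\<^esub> m) = \<one>\<^bsub>Q\<^esub>"
  shows "\<tau> (c \<otimes>\<^bsub>Q\<^esub> \<rho> u [^]\<^bsub>Q\<^esub> s) (u [^]\<^bsub>F\<^esub> m) =
    inv\<^bsub>B\<^esub> \<tau> c (u [^]\<^bsub>F\<^esub> s) \<otimes>\<^bsub>B\<^esub> \<tau> c (u [^]\<^bsub>F\<^esub> m) \<otimes>\<^bsub>B\<^esub> \<tau> c (u [^]\<^bsub>F\<^esub> s)"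
proof -
  interpret B: group B by fact
  interpret \<rho>: group_hom F Q \<rho> using Q F \<rho> by (auto simp: group_hom_def group_hom_axioms_def)
  have us: "\<rho> (u [^]\<^bsub>F\<^esub> s) = \<rho> u [^]\<^bsub>Q\<^esub> s" using u by (simp add: \<rho>.hom_nat_pow)
  have q: "c \<otimes>\<^bsub>Q\<^esub> \<rho> u [^]\<^bsub>Q\<^esub> s \<in> carrier Q" using c u by simp
  have "\<tau> c (u [^]\<^bsub>F\<^esub> s) \<otimes>\<^bsub>B\<^esub> \<tau> (c \<otimes>\<^bsub>Q\<^esub> \<rho> u [^]\<^bsub>Q\<^esub> s) (u [^]\<^bsub>F\<^esub> m)
      = \<tau> c (u [^]\<^bsub>F\<^esub> s \<otimes>\<^bsub>F\<^esub> u [^]\<^bsub>F\<^esub> m)"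
    using c u us by (simp add: \<tau>_mult)
  also have "u [^]\<^bsub>F\<^esub> s \<otimes>\<^bsub>F\<^esub> u [^]\<^bsub>F\<^esub> m = u [^]\<^bsub>F\<^esub> m \<otimes>\<^bsub>F\<^esub> u [^]\<^bsub>F\<^esub> s"
    using u by (simp add: \<rho>.G.nat_pow_mult add.commute)
  also have "\<tau> c \<dots> = \<tau> c (u [^]\<^bsub>F\<^esub> m) \<otimes>\<^bsub>B\<^esub> \<tau> c (u [^]\<^bsub>F\<^esub> s)"
    using c u um by (simp add: \<tau>_mult)
  finally have *: "\<tau> c (u [^]\<^bsub>F\<^esub> s) \<otimes>\<^bsub>B\<^esub> \<tau> (c \<otimes>\<^bsub>Q\<^esub> \<rho> u [^]\<^bsub>Q\<^esub> s) (u [^]\<^bsub>F\<^esub> m)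
      = \<tau> c (u [^]\<^bsub>F\<^esub> m) \<otimes>\<^bsub>B\<^esub> \<tau> c (u [^]\<^bsub>F\<^esub> s)" .
  show ?thesis
    using * c u q \<tau>_closed by (simp add: B.m_assoc B.inv_solve_left)
qed

section \<open>Reidemeister rewriting\<close>

text \<open>The state group \<open>Q\<close> acts as the vertex set of a cover of the rose with petals \<open>X\<close>; the letter
  \<open>e (q, x)\<close> stands for the edge that leaves \<open>q\<close> along \<open>x\<close>, and \<open>\<tau> q w\<close> is the edge path that
  \<open>w\<close> traverses from \<open>q\<close>. The word \<open>t q\<close> is a path from the base point \<open>\<one>\<close> to \<open>q\<close>. In the
  presentations below, relators that make these paths trivial replace the choice of a spanning tree.\<close>

locale reidemeister_rewriting = Q: group Q for Q :: "('q, 'n) monoid_scheme" +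
  fixes X :: "'x set" and Y :: "'y set" and \<rho> :: "'x word \<Rightarrow> 'q"
    and t :: "'q \<Rightarrow> 'x word" and e :: "'q \<times> 'x \<Rightarrow> 'y" and \<tau> :: "'q \<Rightarrow> 'x word \<Rightarrow> 'y word"
  assumes \<rho>_hom: "\<rho> \<in> hom (free_group X) Q"
    and t: "\<And>q. q \<in> carrier Q \<Longrightarrow> t q \<in> carrier (free_group X)"
    and \<rho>_t: "\<And>q. q \<in> carrier Q \<Longrightarrow> \<rho> (t q) = q"
    and t_one: "t \<one>\<^bsub>Q\<^esub> = \<one>\<^bsub>free_group X\<^esub>"
    and e: "bij_betw e (carrier Q \<times> X) Y"
    and \<tau>_closed: "\<And>q w. q \<in> carrier Q \<Longrightarrow> w \<in> carrier (free_group X) \<Longrightarrow>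
       \<tau> q w \<in> carrier (free_group Y)"
    and \<tau>_mult: "\<And>q v w. q \<in> carrier Q \<Longrightarrow> v \<in> carrier (free_group X) \<Longrightarrow>
       w \<in> carrier (free_group X) \<Longrightarrow>
       \<tau> q (v \<otimes>\<^bsub>free_group X\<^esub> w) = \<tau> q v \<otimes>\<^bsub>free_group Y\<^esub> \<tau> (q \<otimes>\<^bsub>Q\<^esub> \<rho> v) w"
    and \<tau>_gen: "\<And>q x. q \<in> carrier Q \<Longrightarrow> x \<in> X \<Longrightarrow> \<tau> q [(x, True)] = [(e (q, x), True)]"
begin

sublocale X: group "free_group X" by (rule group_free_group)
sublocale Y: group "free_group Y" by (rule group_free_group)
sublocale \<rho>: group_hom "free_group X" Q \<rho>
  using \<rho>_hom by (simp add: group_hom_def group_hom_axioms_def X.is_group Q.is_group)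

lemma Y_cases:
  assumes "y \<in> Y"
  obtains q x where "q \<in> carrier Q" "x \<in> X" "y = e (q, x)"
  using assms e by (force simp: bij_betw_def)

lemma e_in_Y: "q \<in> carrier Q \<Longrightarrow> x \<in> X \<Longrightarrow> e (q, x) \<in> Y"
  using e by (auto simp: bij_betw_def)

lemma \<tau>_one:
  assumes q: "q \<in> carrier Q"
  shows "\<tau> q \<one>\<^bsub>free_group X\<^esub> = \<one>\<^bsub>free_group Y\<^esub>"
proof -
  have "\<tau> q \<one>\<^bsub>free_group X\<^esub> \<otimes>\<^bsub>free_group Y\<^esub> \<tau> q \<one>\<^bsub>free_group X\<^esub> = \<tau> q \<one>\<^bsub>free_group X\<^esub>"
    using \<tau>_mult[OF q X.one_closed X.one_closed] q by simp
  then show ?thesis using Y.l_cancel_one[of "\<tau> q \<one>\<^bsub>free_group X\<^esub>"] \<tau>_closed[OF q X.one_closed] by metis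
qed

lemma \<tau>_inv:
  assumes q: "q \<in> carrier Q" and w: "w \<in> carrier (free_group X)"
  shows "\<tau> (q \<otimes>\<^bsub>Q\<^esub> \<rho> w) (inv\<^bsub>free_group X\<^esub> w) = inv\<^bsub>free_group Y\<^esub> \<tau> q w"
proof -
  have "\<tau> q w \<otimes>\<^bsub>free_group Y\<^esub> \<tau> (q \<otimes>\<^bsub>Q\<^esub> \<rho> w) (inv\<^bsub>free_group X\<^esub> w) = \<one>\<^bsub>free_group Y\<^esub>"
    using \<tau>_mult[OF q w X.inv_closed[OF w]] \<tau>_one[OF q] w by simp
  then show ?thesis
    using q w by (intro Y.eq_inv_if_mult_eq_one) (simp_all add: \<tau>_closed)
qed

text \<open>A word read from \<open>q\<close>, closed up to a loop at the base point by the chosen paths.\<close>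

definition schreier_elt :: "'q \<Rightarrow> 'x word \<Rightarrow> 'x word" where
  "schreier_elt q w = t q \<otimes>\<^bsub>free_group X\<^esub> w \<otimes>\<^bsub>free_group X\<^esub> inv\<^bsub>free_group X\<^esub> t (q \<otimes>\<^bsub>Q\<^esub> \<rho> w)"

lemma schreier_elt_closed:
  "q \<in> carrier Q \<Longrightarrow> w \<in> carrier (free_group X) \<Longrightarrow> schreier_elt q w \<in> carrier (free_group X)"
  by (simp add: schreier_elt_def t)

lemma \<rho>_schreier_elt:
  "q \<in> carrier Q \<Longrightarrow> w \<in> carrier (free_group X) \<Longrightarrow> \<rho> (schreier_elt q w) = \<one>\<^bsub>Q\<^esub>"
  by (simp add: schreier_elt_def t \<rho>_t)

lemma schreier_elt_mult:
  assumes "q \<in> carrier Q" "v \<in> carrier (free_group X)" "w \<in> carrier (free_group X)"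
  shows "schreier_elt q (v \<otimes>\<^bsub>free_group X\<^esub> w) =
    schreier_elt q v \<otimes>\<^bsub>free_group X\<^esub> schreier_elt (q \<otimes>\<^bsub>Q\<^esub> \<rho> v) w"
proof -
  have cancel: "inv\<^bsub>free_group X\<^esub> a \<otimes>\<^bsub>free_group X\<^esub> (a \<otimes>\<^bsub>free_group X\<^esub> b) = b"
    if "a \<in> carrier (free_group X)" "b \<in> carrier (free_group X)" for a b
    using that by (simp add: X.m_assoc[symmetric])
  show ?thesis using assms by (simp add: schreier_elt_def t Q.m_assoc X.m_assoc cancel)
qed

lemma schreier_elt_kernel:
  assumes "w \<in> carrier (free_group X)" "\<rho> w = \<one>\<^bsub>Q\<^esub>"
  shows "schreier_elt \<one>\<^bsub>Q\<^esub> w = w"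
  using assms by (simp add: schreier_elt_def t_one)

lemma letter_X: "x \<in> X \<Longrightarrow> [(x, b)] \<in> carrier (free_group X)"
  by (simp add: letter_in_free_group)

text \<open>The homomorphism that sends each edge of the cover to the loop around it.\<close>

definition unrewrite :: "'y word \<Rightarrow> 'x word" where
  "unrewrite = (SOME k. k \<in> hom (free_group Y) (free_group X) \<and>
     (\<forall>q\<in>carrier Q. \<forall>x\<in>X. k [(e (q, x), True)] = schreier_elt q [(x, True)]))"

lemma unrewrite_hom: "unrewrite \<in> hom (free_group Y) (free_group X)"
  and unrewrite_gen: "\<And>q x. q \<in> carrier Q \<Longrightarrow> x \<in> X \<Longrightarrow>
    unrewrite [(e (q, x), True)] = schreier_elt q [(x, True)]"
proof -
  define e' where "e' = the_inv_into (carrier Q \<times> X) e"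
  have e': "e' (e (q, x)) = (q, x)" if "q \<in> carrier Q" "x \<in> X" for q x
    using that e unfolding e'_def by (intro the_inv_into_f_f) (auto simp: bij_betw_def)
  define f where "f y = (case e' y of (q, x) \<Rightarrow> schreier_elt q [(x, True)])" for y
  have "f y \<in> carrier (free_group X)" if "y \<in> Y" for y
    using that by (rule Y_cases) (simp add: f_def e' schreier_elt_closed letter_X)
  then obtain h where "h \<in> hom (free_group Y) (free_group X)" "\<And>y. y \<in> Y \<Longrightarrow> h [(y, True)] = f y"
    using free_group_lift[OF X.is_group, of Y f] by blast
  then have "\<exists>k. k \<in> hom (free_group Y) (free_group X) \<and>
     (\<forall>q\<in>carrier Q. \<forall>x\<in>X. k [(e (q, x), True)] = schreier_elt q [(x, True)])"
    using e' e_in_Y by (intro exI[of _ h]) (auto simp: f_def)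
  from someI_ex[OF this, folded unrewrite_def]
  show "unrewrite \<in> hom (free_group Y) (free_group X)"
    "\<And>q x. q \<in> carrier Q \<Longrightarrow> x \<in> X \<Longrightarrow> unrewrite [(e (q, x), True)] = schreier_elt q [(x, True)]"
    by auto
qed

sublocale k: group_hom "free_group Y" "free_group X" unrewrite
  using unrewrite_hom by (simp add: group_hom_def group_hom_axioms_def X.is_group Y.is_group)

lemma \<rho>_unrewrite:
  assumes v: "v \<in> carrier (free_group Y)"
  shows "\<rho> (unrewrite v) = \<one>\<^bsub>Q\<^esub>"
proof -
  have hom1: "\<rho> \<circ> unrewrite \<in> hom (free_group Y) Q" using unrewrite_hom \<rho>_hom by (rule Group.hom_compose)
  have hom2: "(\<lambda>_. \<one>\<^bsub>Q\<^esub>) \<in> hom (free_group Y) Q" by (simp add: hom_def)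
  have "(\<rho> \<circ> unrewrite) v = \<one>\<^bsub>Q\<^esub>"
  proof (rule free_group_hom_eq[OF Q.is_group hom1 hom2 _ v])
    show "(\<rho> \<circ> unrewrite) [(y, True)] = \<one>\<^bsub>Q\<^esub>" if "y \<in> Y" for y
      using that by (rule Y_cases) (simp add: unrewrite_gen \<rho>_schreier_elt letter_X)
  qed
  then show ?thesis by simp
qed

text \<open>Both sides are crossed homomorphisms in \<open>w\<close>, and they agree on the generators. On the kernel of \<open>\<rho>\<close>
  and for the base point, the right-hand side is \<open>w\<close>, so that \<open>unrewrite\<close> undoes the rewriting there.\<close>

lemma unrewrite_\<tau>:
  assumes q: "q \<in> carrier Q" and w: "w \<in> carrier (free_group X)"
  shows "unrewrite (\<tau> q w) = schreier_elt q w"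
proof -
  have letter: "unrewrite (\<tau> q [a]) = schreier_elt q [a]" if "q \<in> carrier Q" "fst a \<in> X" for q a
  proof (cases a)
    case (Pair x b)
    have x: "x \<in> X" using that Pair by simp
    let ?x = "[(x, True)]"
    show ?thesis
    proof (cases b)
      case True
      then show ?thesis using that Pair by (simp add: \<tau>_gen unrewrite_gen)
    next
      case False
      \<comment> \<open>the state from which the edge is traversed forwards\<close>
      define p where "p = q \<otimes>\<^bsub>Q\<^esub> inv\<^bsub>Q\<^esub> \<rho> ?x"
      have p: "p \<in> carrier Q" and q: "q = p \<otimes>\<^bsub>Q\<^esub> \<rho> ?x"
        using that x by (simp_all add: p_def letter_X Q.m_assoc)
      have a: "[a] = inv\<^bsub>free_group X\<^esub> ?x"
        using Pair False x by (simp add: inv_letter_free_group)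
      have "schreier_elt p ?x \<otimes>\<^bsub>free_group X\<^esub> schreier_elt q [a] = \<one>\<^bsub>free_group X\<^esub>"
        using schreier_elt_mult[of p ?x "[a]"] p x
        by (simp add: q a letter_X) (simp add: schreier_elt_def t p)
      then have "schreier_elt q [a] = inv\<^bsub>free_group X\<^esub> schreier_elt p ?x"
        using p x that
        by (intro X.eq_inv_if_mult_eq_one) (simp_all add: schreier_elt_closed letter_X a)
      moreover have "\<tau> q [a] = inv\<^bsub>free_group Y\<^esub> \<tau> p ?x"
        using \<tau>_inv[of p ?x] p x by (simp add: q a letter_X)
      ultimately show ?thesis
        using p x by (simp add: \<tau>_gen unrewrite_gen e_in_Y letter_in_free_group)
    qed
  qed
  show ?thesis using q w
  proof (induction w arbitrary: q)
    case Nil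
    then show ?case
      using \<tau>_one[of q] by (simp add: schreier_elt_def t one_free_group[of X, symmetric])
  next
    case (Cons a w)
    note D = Cons_in_free_groupD[OF Cons.prems(2)]
    have a: "[a] \<in> carrier (free_group X)" using D(1) by (rule letter_in_free_group)
    have "unrewrite (\<tau> q ([a] \<otimes>\<^bsub>free_group X\<^esub> w)) = schreier_elt q ([a] \<otimes>\<^bsub>free_group X\<^esub> w)"
      using Cons.prems(1) a D Cons.IH[of "q \<otimes>\<^bsub>Q\<^esub> \<rho> [a]"] letter[of q a]
      by (simp add: \<tau>_mult schreier_elt_mult \<tau>_closed)
    then show ?case using D(3) by simp
  qed
qed

lemma \<tau>_one_hom_on_kernel:
  assumes "v \<in> carrier (free_group X)" "w \<in> carrier (free_group X)" "\<rho> v = \<one>\<^bsub>Q\<^esub>"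
  shows "\<tau> \<one>\<^bsub>Q\<^esub> (v \<otimes>\<^bsub>free_group X\<^esub> w) = \<tau> \<one>\<^bsub>Q\<^esub> v \<otimes>\<^bsub>free_group Y\<^esub> \<tau> \<one>\<^bsub>Q\<^esub> w"
  using \<tau>_mult[of "\<one>\<^bsub>Q\<^esub>" v w] assms by simp

text \<open>The rewriting of the loop around an edge is that edge, surrounded by the rewritten paths \<open>t q\<close>, so
  these are the only relators needed to make rewriting inverse to \<open>unrewrite\<close>.\<close>

lemma \<tau>_unrewrite:
  assumes M: "M \<lhd> free_group Y" and t_M: "\<And>q. q \<in> carrier Q \<Longrightarrow> \<tau> \<one>\<^bsub>Q\<^esub> (t q) \<in> M"
    and v: "v \<in> carrier (free_group Y)"
  shows "M #>\<^bsub>free_group Y\<^esub> \<tau> \<one>\<^bsub>Q\<^esub> (unrewrite v) = M #>\<^bsub>free_group Y\<^esub> v"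
proof -
  interpret M: normal M "free_group Y" by fact
  let ?p = "\<lambda>v. M #>\<^bsub>free_group Y\<^esub> v"
  have p: "?p \<in> hom (free_group Y) (free_group Y Mod M)" by (rule M.r_coset_hom_Mod)
  interpret p: group_hom "free_group Y" "free_group Y Mod M" ?p
    using p M.factorgroup_is_group by (simp add: group_hom_def group_hom_axioms_def Y.is_group)
  have "(\<lambda>v. \<tau> \<one>\<^bsub>Q\<^esub> (unrewrite v)) \<in> hom (free_group Y) (free_group Y)"
    by (intro homI) (simp_all add: \<tau>_closed \<tau>_one_hom_on_kernel \<rho>_unrewrite)
  from Group.hom_compose[OF this p]
  have hom: "(\<lambda>v. ?p (\<tau> \<one>\<^bsub>Q\<^esub> (unrewrite v))) \<in> hom (free_group Y) (free_group Y Mod M)"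
    by (simp add: o_def)
  show ?thesis
  proof (rule free_group_hom_eq[OF M.factorgroup_is_group hom p _ v])
    fix y assume "y \<in> Y"
    then obtain q x where q: "q \<in> carrier Q" and x: "x \<in> X" and y: "y = e (q, x)" by (rule Y_cases)
    define q' where "q' = q \<otimes>\<^bsub>Q\<^esub> \<rho> [(x, True)]"
    have q': "q' \<in> carrier Q" using q x by (simp add: q'_def letter_X)
    have one: "?p (\<tau> \<one>\<^bsub>Q\<^esub> (t s)) = \<one>\<^bsub>free_group Y Mod M\<^esub>" if "s \<in> carrier Q" for s
      using that t_M M.rcos_eq_self_iff by (simp add: \<tau>_closed t)
    have "\<tau> q' (inv\<^bsub>free_group X\<^esub> t q') = inv\<^bsub>free_group Y\<^esub> \<tau> \<one>\<^bsub>Q\<^esub> (t q')"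
      using \<tau>_inv[of "\<one>\<^bsub>Q\<^esub>" "t q'"] q' by (simp add: t \<rho>_t)
    then have "\<tau> \<one>\<^bsub>Q\<^esub> (schreier_elt q [(x, True)]) =
        \<tau> \<one>\<^bsub>Q\<^esub> (t q) \<otimes>\<^bsub>free_group Y\<^esub> [(y, True)] \<otimes>\<^bsub>free_group Y\<^esub> inv\<^bsub>free_group Y\<^esub> \<tau> \<one>\<^bsub>Q\<^esub> (t q')"
      using q x q' by (simp add: schreier_elt_def \<tau>_mult t \<rho>_t letter_X \<tau>_gen y flip: q'_def)
    then show "?p (\<tau> \<one>\<^bsub>Q\<^esub> (unrewrite [(y, True)])) = ?p [(y, True)]"
      using q x q' one e_in_Y
      by (simp add: unrewrite_gen y \<tau>_closed t letter_in_free_group del: mult_FactGroup one_FactGroup)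
  qed
qed

text \<open>The words that fix every state and are rewritten into \<open>M\<close> from every state form a normal subgroup:
  conjugating such a word by \<open>x\<close> conjugates its rewriting, now read from the state that \<open>x\<close>
  leads to. All states have to be considered at once, since conjugation changes the starting point.\<close>

lemma \<tau>_normal_closure:
  assumes M: "M \<lhd> free_group Y" and R: "R \<subseteq> carrier (free_group X)"
    and \<rho>_R: "\<And>w. w \<in> R \<Longrightarrow> \<rho> w = \<one>\<^bsub>Q\<^esub>"
    and R_M: "\<And>q w. q \<in> carrier Q \<Longrightarrow> w \<in> R \<Longrightarrow> \<tau> q w \<in> M"
    and w: "w \<in> normal_closure (free_group X) R"
  shows "\<tau> \<one>\<^bsub>Q\<^esub> w \<in> M"
proof -
  interpret M: normal M "free_group Y" by fact
  define E where "E = {w \<in> carrier (free_group X). \<rho> w = \<one>\<^bsub>Q\<^esub> \<and> (\<forall>q\<in>carrier Q. \<tau> q w \<in> M)}"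
  have "E \<lhd> free_group X"
  proof (rule X.normal_invI)
    show "subgroup E (free_group X)"
    proof (rule X.subgroupI)
      have "\<one>\<^bsub>free_group X\<^esub> \<in> E" by (simp add: E_def \<tau>_one)
      then show "E \<noteq> {}" by blast
      show "inv\<^bsub>free_group X\<^esub> a \<in> E" if "a \<in> E" for a
        using that \<tau>_inv[of _ a] by (auto simp: E_def) 
      show "a \<otimes>\<^bsub>free_group X\<^esub> b \<in> E" if "a \<in> E" "b \<in> E" for a b
        using that by (simp add: E_def \<tau>_mult)
    qed (auto simp: E_def)
    show "x \<otimes>\<^bsub>free_group X\<^esub> w \<otimes>\<^bsub>free_group X\<^esub> inv\<^bsub>free_group X\<^esub> x \<in> E"
      if x: "x \<in> carrier (free_group X)" and w: "w \<in> E" for x w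
    proof -
      have "\<tau> q (x \<otimes>\<^bsub>free_group X\<^esub> w \<otimes>\<^bsub>free_group X\<^esub> inv\<^bsub>free_group X\<^esub> x) \<in> M" if q: "q \<in> carrier Q" for q
        using w x q \<tau>_inv[OF q x] M.inv_op_closed2[of "\<tau> q x" "\<tau> (q \<otimes>\<^bsub>Q\<^esub> \<rho> x) w"]
        by (simp add: E_def \<tau>_mult \<tau>_closed Y.m_assoc)
      then show ?thesis using w x by (simp add: E_def)
    qed
  qed
  moreover have "R \<subseteq> E" using R \<rho>_R R_M by (auto simp: E_def)
  ultimately have "normal_closure (free_group X) R \<subseteq> E" by (rule normal_closure_minimal)
  then show ?thesis using w by (auto simp: E_def)
qed

end

section \<open>Presentations of kernels of maps to finite groups\<close>

text \<open>By the first isomorphism theorem it suffices to find the kernel of the composition of \<open>unrewrite\<close> with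
  the projection. If \<open>unrewrite v\<close> is a consequence of the relators \<open>R\<close>, then its rewriting is a
  consequence of \<open>S\<close>; modulo \<open>S\<close> this rewriting is \<open>v\<close> itself.\<close>

lemma (in reidemeister_rewriting) kernel_presentation:
  assumes R: "R \<subseteq> carrier (free_group X)" and S: "S \<subseteq> carrier (free_group Y)"
    and \<rho>_R: "\<And>w. w \<in> R \<Longrightarrow> \<rho> w = \<one>\<^bsub>Q\<^esub>"
    and t_S: "\<And>q. q \<in> carrier Q \<Longrightarrow> \<tau> \<one>\<^bsub>Q\<^esub> (t q) \<in> normal_closure (free_group Y) S"
    and R_S: "\<And>q w. q \<in> carrier Q \<Longrightarrow> w \<in> R \<Longrightarrow> \<tau> q w \<in> normal_closure (free_group Y) S"
    and S_R: "\<And>s. s \<in> S \<Longrightarrow> unrewrite s \<in> normal_closure (free_group X) R"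
  shows "presented_group X R\<lparr>carrier := presentation_proj X R ` kernel (free_group X) Q \<rho>\<rparr>
    \<cong> presented_group Y S"
proof -
  define M where "M = normal_closure (free_group Y) S"
  define L where "L = normal_closure (free_group X) R"
  define \<pi> where "\<pi> = presentation_proj X R"
  define N where "N = \<pi> ` kernel (free_group X) Q \<rho>"
  define GN where "GN = presented_group X R\<lparr>carrier := N\<rparr>"
  interpret M: normal M "free_group Y" unfolding M_def by (rule Y.normal_normal_closure[OF S])
  interpret L: normal L "free_group X" unfolding L_def by (rule X.normal_normal_closure[OF R])
  interpret \<pi>: group_hom "free_group X" "presented_group X R" \<pi>
    using R by (simp add: group_hom_def group_hom_axioms_def X.is_group group_presented_group
        presentation_proj_hom \<pi>_def)
  have \<pi>_one: "\<pi> w = \<one>\<^bsub>presented_group X R\<^esub> \<longleftrightarrow> w \<in> L" if "w \<in> carrier (free_group X)" for w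
    using that R by (simp add: \<pi>_def L_def presentation_proj_eq_one_iff)
  have subN: "subgroup N (presented_group X R)"
    unfolding N_def by (rule \<pi>.subgroup_img_is_subgroup[OF \<rho>.subgroup_kernel])
  have grp: "group GN" unfolding GN_def by (rule \<pi>.H.subgroup_imp_group[OF subN])
  define h where "h = (\<lambda>v. \<pi> (unrewrite v))"
  have h: "h \<in> hom (free_group Y) GN"
    by (intro homI) (auto simp: h_def GN_def N_def kernel_def \<rho>_unrewrite)
  interpret h: group_hom "free_group Y" GN h
    using h grp by (simp add: group_hom_def group_hom_axioms_def Y.is_group)
  have ker: "v \<in> kernel (free_group Y) GN h \<longleftrightarrow> v \<in> carrier (free_group Y) \<and> unrewrite v \<in> L" for v
    using \<pi>_one[of "unrewrite v"] by (cases "v \<in> carrier (free_group Y)") (simp_all add: kernel_def h_def GN_def)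
  have "kernel (free_group Y) GN h = M"
  proof
    show "M \<subseteq> kernel (free_group Y) GN h"
      unfolding M_def using S S_R
      by (intro normal_closure_minimal h.normal_kernel) (auto simp: ker L_def)
    show "kernel (free_group Y) GN h \<subseteq> M"
    proof
      fix v assume "v \<in> kernel (free_group Y) GN h"
      then have v: "v \<in> carrier (free_group Y)" and L: "unrewrite v \<in> L" by (auto simp: ker)
      have "\<tau> \<one>\<^bsub>Q\<^esub> (unrewrite v) \<in> M"
        using \<tau>_normal_closure[OF M.normal_axioms R \<rho>_R] R_S L by (simp add: M_def L_def)
      then have "M #>\<^bsub>free_group Y\<^esub> \<tau> \<one>\<^bsub>Q\<^esub> (unrewrite v) = M"
        using v by (simp add: M.rcos_eq_self_iff \<tau>_closed)
      then have "M #>\<^bsub>free_group Y\<^esub> v = M"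
        using \<tau>_unrewrite[OF M.normal_axioms _ v] t_S by (simp add: M_def)
      then show "v \<in> M" using v by (simp add: M.rcos_eq_self_iff)
    qed
  qed
  moreover have "h ` carrier (free_group Y) = carrier GN"
  proof
    show "h ` carrier (free_group Y) \<subseteq> carrier GN" using h by (auto simp: hom_def)
    show "carrier GN \<subseteq> h ` carrier (free_group Y)"
    proof
      fix g assume "g \<in> carrier GN"
      then obtain w where w: "w \<in> carrier (free_group X)" "\<rho> w = \<one>\<^bsub>Q\<^esub>" "g = \<pi> w"
        by (auto simp: GN_def N_def kernel_def)
      then have "h (\<tau> \<one>\<^bsub>Q\<^esub> w) = g" by (simp add: h_def unrewrite_\<tau> schreier_elt_kernel)
      then show "g \<in> h ` carrier (free_group Y)" using w \<tau>_closed[OF Q.one_closed, of w] by blast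
    qed
  qed
  ultimately have "presented_group Y S \<cong> GN"
    using h.FactGroup_iso by (simp add: presented_group_def M_def)
  then show ?thesis
    using group.iso_sym[OF group_presented_group[OF S]] by (simp add: GN_def N_def \<pi>_def)
qed

text \<open>The relators are the rewritten paths to the states other than the base point, and the rewriting of
  each power relator from one state in every left coset of the subgroup generated by its root.\<close>

lemma (in reidemeister_rewriting) kernel_presentation_powers:
  fixes u :: "'i \<Rightarrow> 'x word" and m :: "'i \<Rightarrow> nat"
  assumes fin: "finite (carrier Q)" and finI: "finite I"
    and u: "\<And>i. i \<in> I \<Longrightarrow> u i \<in> carrier (free_group X)"
    and um: "\<And>i. i \<in> I \<Longrightarrow> \<rho> (u i [^]\<^bsub>free_group X\<^esub> m i) = \<one>\<^bsub>Q\<^esub>"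
  defines "R \<equiv> (\<lambda>i. u i [^]\<^bsub>free_group X\<^esub> m i) ` I"
  obtains S where "S \<subseteq> carrier (free_group Y)" "finite S"
    "real (card S) \<le> real (order Q) - 1 + (\<Sum>i\<in>I. real (order Q) / real (group.ord Q (\<rho> (u i))))"
    "presented_group X R\<lparr>carrier := presentation_proj X R ` kernel (free_group X) Q \<rho>\<rparr>
      \<cong> presented_group Y S"
proof -
  have "\<forall>i\<in>I. \<exists>C. C \<subseteq> carrier Q \<and> card C * Q.ord (\<rho> (u i)) = order Q \<and>
      (\<forall>q\<in>carrier Q. \<exists>c\<in>C. \<exists>k::nat. q = c \<otimes>\<^bsub>Q\<^esub> \<rho> (u i) [^]\<^bsub>Q\<^esub> k)"
  proof
    fix i assume "i \<in> I"
    then have "\<rho> (u i) \<in> carrier Q" using u by simp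
    from Q.left_coset_representatives[OF fin this]
    obtain C where "C \<subseteq> carrier Q" "card C * Q.ord (\<rho> (u i)) = order Q"
      "\<And>q. q \<in> carrier Q \<Longrightarrow> \<exists>c\<in>C. \<exists>k::nat. q = c \<otimes>\<^bsub>Q\<^esub> \<rho> (u i) [^]\<^bsub>Q\<^esub> k" by blast
    then show "\<exists>C. C \<subseteq> carrier Q \<and> card C * Q.ord (\<rho> (u i)) = order Q \<and>
      (\<forall>q\<in>carrier Q. \<exists>c\<in>C. \<exists>k::nat. q = c \<otimes>\<^bsub>Q\<^esub> \<rho> (u i) [^]\<^bsub>Q\<^esub> k)" by blast
  qed
  then obtain C where C: "\<And>i. i \<in> I \<Longrightarrow> C i \<subseteq> carrier Q"
    and C_card: "\<And>i. i \<in> I \<Longrightarrow> card (C i) * Q.ord (\<rho> (u i)) = order Q"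
    and C_rep: "\<And>i q. i \<in> I \<Longrightarrow> q \<in> carrier Q \<Longrightarrow>
      \<exists>c\<in>C i. \<exists>k::nat. q = c \<otimes>\<^bsub>Q\<^esub> \<rho> (u i) [^]\<^bsub>Q\<^esub> k"
    unfolding bchoice_iff by blast
  define r where "r i = u i [^]\<^bsub>free_group X\<^esub> m i" for i
  have r: "r i \<in> carrier (free_group X)" "\<rho> (r i) = \<one>\<^bsub>Q\<^esub>" if "i \<in> I" for i
    using that u um by (simp_all add: r_def)
  have R_r: "R = r ` I" by (simp add: R_def r_def)
  have R: "R \<subseteq> carrier (free_group X)" using r by (auto simp: R_r)
  define T where "T = (\<lambda>q. \<tau> \<one>\<^bsub>Q\<^esub> (t q)) ` (carrier Q - {\<one>\<^bsub>Q\<^esub>})"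
  define V where "V = (\<Union>i\<in>I. (\<lambda>c. \<tau> c (r i)) ` C i)"
  define S where "S = T \<union> V"
  define M where "M = normal_closure (free_group Y) S"
  have S: "S \<subseteq> carrier (free_group Y)"
    using r C by (fastforce simp: S_def T_def V_def t intro!: \<tau>_closed)
  interpret M: normal M "free_group Y" unfolding M_def by (rule Y.normal_normal_closure[OF S])
  have S_M: "S \<subseteq> M" unfolding M_def by (rule Y.subset_normal_closure[OF S])
  have finC: "finite (C i)" if "i \<in> I" for i using C[OF that] fin by (rule finite_subset)
  have "card T \<le> order Q - 1"
    unfolding T_def order_def using fin
    by (metis Q.one_closed card_Diff_singleton card_image_le finite_Diff)
  moreover have "order Q \<ge> 1" using Q.order_gt_0_iff_finite fin by auto
  ultimately have T: "real (card T) \<le> real (order Q) - 1" by linarith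
  have "card V \<le> (\<Sum>i\<in>I. card ((\<lambda>c. \<tau> c (r i)) ` C i))"
    unfolding V_def by (rule card_UN_le[OF finI])
  also have "\<dots> \<le> (\<Sum>i\<in>I. card (C i))" by (intro sum_mono card_image_le finC)
  finally have "real (card V) \<le> (\<Sum>i\<in>I. real (card (C i)))" by (simp flip: of_nat_sum)
  also have "\<dots> = (\<Sum>i\<in>I. real (order Q) / real (Q.ord (\<rho> (u i))))"
  proof (rule sum.cong)
    fix i assume i: "i \<in> I"
    then have "Q.ord (\<rho> (u i)) \<noteq> 0" using C_card[OF i] \<open>order Q \<ge> 1\<close> by (metis mult_0_right not_one_le_zero)
    then show "real (card (C i)) = real (order Q) / real (Q.ord (\<rho> (u i)))"
      by (simp add: field_simps flip: C_card[OF i])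
  qed simp
  finally have V: "real (card V) \<le> (\<Sum>i\<in>I. real (order Q) / real (Q.ord (\<rho> (u i))))" .
  have \<tau>_R: "\<tau> q (r i) \<in> M" if i: "i \<in> I" and q: "q \<in> carrier Q" for i q
  proof -
    obtain c and k :: nat where c: "c \<in> C i" and q: "q = c \<otimes>\<^bsub>Q\<^esub> \<rho> (u i) [^]\<^bsub>Q\<^esub> k"
      using C_rep[OF i q] by blast
    have cQ: "c \<in> carrier Q" using c C[OF i] by blast
    have "\<tau> c (r i) \<in> M" using c i S_M by (auto simp: S_def V_def)
    then show ?thesis
      using cocycle_pow_conjugate[OF Y.is_group Q.is_group X.is_group \<rho>_hom, of \<tau> c "u i" "m i" k]
        \<tau>_closed \<tau>_mult cQ u um i M.inv_op_closed1[of "\<tau> c (u i [^]\<^bsub>free_group X\<^esub> k)" "\<tau> c (r i)"]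
      by (simp add: q r_def)
  qed
  show thesis
  proof
    show "S \<subseteq> carrier (free_group Y)" by fact
    show "finite S" using fin finI finC by (simp add: S_def T_def V_def)
    show "real (card S) \<le> real (order Q) - 1 + (\<Sum>i\<in>I. real (order Q) / real (Q.ord (\<rho> (u i))))"
      using T V card_Un_le[of T V] by (simp add: S_def)
    show "presented_group X R\<lparr>carrier := presentation_proj X R ` kernel (free_group X) Q \<rho>\<rparr>
      \<cong> presented_group Y S"
    proof (rule kernel_presentation[OF R S])
      show "\<rho> w = \<one>\<^bsub>Q\<^esub>" if "w \<in> R" for w using that r by (auto simp: R_r)
      show "\<tau> \<one>\<^bsub>Q\<^esub> (t q) \<in> normal_closure (free_group Y) S" if "q \<in> carrier Q" for q
      proof (cases "q = \<one>\<^bsub>Q\<^esub>")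
        case True
        then show ?thesis using M.one_closed by (simp add: M_def t_one \<tau>_one)
      next
        case False
        then have "\<tau> \<one>\<^bsub>Q\<^esub> (t q) \<in> S" using that by (auto simp: S_def T_def)
        then show ?thesis using S_M by (auto simp: M_def)
      qed
      show "\<tau> q w \<in> normal_closure (free_group Y) S" if "q \<in> carrier Q" "w \<in> R" for q w
        using that \<tau>_R by (auto simp: R_r M_def)
      show "unrewrite s \<in> normal_closure (free_group X) R" if "s \<in> S" for s
      proof -
        interpret L: normal "normal_closure (free_group X) R" "free_group X"
          by (rule X.normal_normal_closure[OF R])
        from that consider q where "q \<in> carrier Q" "s = \<tau> \<one>\<^bsub>Q\<^esub> (t q)"
          | i c where "i \<in> I" "c \<in> C i" "s = \<tau> c (r i)"
          by (auto simp: S_def T_def V_def)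
        then show ?thesis
        proof cases
          case 1
          then have "unrewrite s = \<one>\<^bsub>free_group X\<^esub>"
            by (simp add: unrewrite_\<tau> t schreier_elt_def t_one \<rho>_t)
          then show ?thesis by simp
        next
          case 2
          then have c: "c \<in> carrier Q" using C by blast
          have "r i \<in> normal_closure (free_group X) R"
            using 2 X.subset_normal_closure[OF R] by (auto simp: R_r)
          then show ?thesis
            using 2 c r[of i] L.inv_op_closed2[OF t[OF c]]
            by (simp add: unrewrite_\<tau> schreier_elt_def)
        qed
      qed
    qed
  qed
qed

text \<open>A cover with \<open>n\<close> vertices has \<open>n d\<close> edges, so that the relators just counted leave a deficiency of at
  least \<open>n d - (n - 1) - \<Sum>\<^sub>i n / o\<^sub>i\<close>, where \<open>n\<close> is the order of \<open>Q\<close> and \<open>o\<^sub>i\<close> the order of the root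
  \<open>u\<^sub>i\<close> in \<open>Q\<close>.\<close>

lemma deficiency_kernel_ge:
  fixes Q :: "('q, 'n) monoid_scheme" and u :: "'i \<Rightarrow> nat word" and m :: "'i \<Rightarrow> nat" and d :: nat
  assumes Q: "group Q" and fin: "finite (carrier Q)" and \<rho>: "\<rho> \<in> hom (free_group {1..d}) Q"
    and surj: "\<rho> ` carrier (free_group {1..d}) = carrier Q"
    and finI: "finite I"
    and u: "\<And>i. i \<in> I \<Longrightarrow> u i \<in> carrier (free_group {1..d})"
    and um: "\<And>i. i \<in> I \<Longrightarrow> \<rho> (u i [^]\<^bsub>free_group {1..d}\<^esub> m i) = \<one>\<^bsub>Q\<^esub>"
  defines "R \<equiv> (\<lambda>i. u i [^]\<^bsub>free_group {1..d}\<^esub> m i) ` I"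
  shows "deficiency (presented_group {1..d} R
      \<lparr>carrier := presentation_proj {1..d} R ` kernel (free_group {1..d}) Q \<rho>\<rparr>)
    \<ge> ereal (1 + real (order Q) * (real d - 1 - (\<Sum>i\<in>I. 1 / real (group.ord Q (\<rho> (u i))))))"
proof -
  define X where "X = {1..d}"
  define Y where "Y = {1..order Q * d}"
  interpret Q: group Q by fact
  obtain t where t: "\<And>q. q \<in> carrier Q \<Longrightarrow> t q \<in> carrier (free_group X) \<and> \<rho> (t q) = q"
    and t_one: "t \<one>\<^bsub>Q\<^esub> = \<one>\<^bsub>free_group X\<^esub>"
  proof -
    have "\<forall>q\<in>carrier Q. \<exists>w. w \<in> carrier (free_group X) \<and> \<rho> w = q" using surj by (force simp: X_def)
    then obtain t0 where "\<forall>q\<in>carrier Q. t0 q \<in> carrier (free_group X) \<and> \<rho> (t0 q) = q"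
      unfolding bchoice_iff by blast
    moreover have "\<one>\<^bsub>free_group X\<^esub> \<in> carrier (free_group X)"
      using group.is_monoid[OF group_free_group] by (rule monoid.one_closed)
    moreover have "\<rho> \<one>\<^bsub>free_group X\<^esub> = \<one>\<^bsub>Q\<^esub>"
      using hom_one[OF \<rho> group_free_group Q] by (simp add: X_def)
    \<comment> \<open>The trivial word as path to the base point saves one relator.\<close>
    ultimately show thesis by (intro that[of "t0(\<one>\<^bsub>Q\<^esub> := \<one>\<^bsub>free_group X\<^esub>)"]) auto
  qed
  have "card (carrier Q \<times> X) = card Y"
    by (simp add: card_cartesian_product X_def Y_def order_def)
  then obtain e where e: "bij_betw e (carrier Q \<times> X) Y"
    using finite_same_card_bij[of "carrier Q \<times> X" Y] fin by (auto simp: Y_def X_def)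
  have letter: "[(e (q, x), True)] \<in> carrier (free_group Y)" if "q \<in> carrier Q" "x \<in> X" for q x
    using that e by (intro letter_in_free_group) (auto simp: bij_betw_def)
  obtain \<tau> where \<tau>: "\<And>q w. q \<in> carrier Q \<Longrightarrow> w \<in> carrier (free_group X) \<Longrightarrow> \<tau> q w \<in> carrier (free_group Y)"
    "\<And>q v w. q \<in> carrier Q \<Longrightarrow> v \<in> carrier (free_group X) \<Longrightarrow> w \<in> carrier (free_group X) \<Longrightarrow>
       \<tau> q (v \<otimes>\<^bsub>free_group X\<^esub> w) = \<tau> q v \<otimes>\<^bsub>free_group Y\<^esub> \<tau> (q \<otimes>\<^bsub>Q\<^esub> \<rho> v) w"
    "\<And>q x. q \<in> carrier Q \<Longrightarrow> x \<in> X \<Longrightarrow> \<tau> q [(x, True)] = [(e (q, x), True)]"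
    by (rule free_group_cocycle[OF group_free_group[of Y] Q \<rho>[folded X_def], of "\<lambda>q x. [(e (q, x), True)]"])
      (use letter in blast)+
  interpret reidemeister_rewriting Q X Y \<rho> t e \<tau>
    by unfold_locales (use t t_one e \<tau> \<rho> in \<open>simp_all add: X_def\<close>)
  obtain S where S: "S \<subseteq> carrier (free_group Y)" "finite S"
    and card: "real (card S) \<le> real (order Q) - 1 + (\<Sum>i\<in>I. real (order Q) / real (Q.ord (\<rho> (u i))))"
    and iso: "presented_group X R\<lparr>carrier := presentation_proj X R ` kernel (free_group X) Q \<rho>\<rparr>
      \<cong> presented_group Y S"
    unfolding R_def X_def[symmetric]
    by (rule kernel_presentation_powers[OF fin finI u[folded X_def] um[folded X_def]])
  obtain rs where rs: "set rs = S" "distinct rs" using finite_distinct_list[OF S(2)] by blast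
  have len: "length rs = card S" using rs distinct_card by metis
  have "finite_presentation_of (presented_group X R
      \<lparr>carrier := presentation_proj X R ` kernel (free_group X) Q \<rho>\<rparr>) (order Q * d) rs"
    using S iso rs by (simp add: finite_presentation_of_def Y_def)
  then have "ereal (real (order Q * d) - real (length rs)) \<le> deficiency (presented_group X R
      \<lparr>carrier := presentation_proj X R ` kernel (free_group X) Q \<rho>\<rparr>)"
    unfolding deficiency_def by (intro Sup_upper) blast
  moreover have "1 + real (order Q) * (real d - 1 - (\<Sum>i\<in>I. 1 / real (Q.ord (\<rho> (u i)))))
      \<le> real (order Q * d) - real (length rs)"
    using card by (simp add: len algebra_simps sum_distrib_left)
  ultimately show ?thesis
    unfolding X_def by (meson ereal_less_eq(3) order_trans)
qed

section \<open>Abelianisations of presented groups\<close>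

definition abelian_image :: "'a set \<Rightarrow> 'a word set \<Rightarrow> 'a word \<Rightarrow> 'a word set set" where
  "abelian_image X R w = abelianisation_proj (presented_group X R) (presentation_proj X R w)"

abbreviation presented_abelianisation :: "'a set \<Rightarrow> 'a word set \<Rightarrow> 'a word set set monoid" where
  "presented_abelianisation X R \<equiv> abelianisation (presented_group X R)"

context
  fixes X :: "'a set" and R :: "'a word set"
  assumes R: "R \<subseteq> carrier (free_group X)"
begin

interpretation F: group "free_group X" by (rule group_free_group)
interpretation G: group "presented_group X R" using R by (rule group_presented_group)
interpretation D: normal "commutator_subgroup (presented_group X R)" "presented_group X R"
  by (rule G.derived_self_is_normal)
interpretation \<pi>: group_hom "free_group X" "presented_group X R" "presentation_proj X R"
  using R by unfold_locales (rule presentation_proj_hom)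

lemma comm_group_presented_abelianisation: "comm_group (presented_abelianisation X R)"
  unfolding abelianisation_def by (rule G.derived_quot_is_comm_group)

lemma abelian_image_hom: "abelian_image X R \<in> hom (free_group X) (presented_abelianisation X R)"
  using Group.hom_compose[OF \<pi>.homh D.r_coset_hom_Mod]
  by (simp add: abelian_image_def[abs_def] abelianisation_def abelianisation_proj_def o_def)

lemma abelian_image_surj:
  "abelian_image X R ` carrier (free_group X) = carrier (presented_abelianisation X R)"
proof -
  have "abelian_image X R ` carrier (free_group X) =
    abelianisation_proj (presented_group X R) ` (presentation_proj X R ` carrier (free_group X))"
    by (auto simp: abelian_image_def)
  then show ?thesis
    using R by (simp add: presentation_proj_surj carrier_FactGroup abelianisation_def abelianisation_proj_def)
qed

lemma abelian_image_eq_one_iff: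
  assumes "w \<in> carrier (free_group X)"
  shows "abelian_image X R w = \<one>\<^bsub>presented_abelianisation X R\<^esub> \<longleftrightarrow>
    presentation_proj X R w \<in> commutator_subgroup (presented_group X R)"
  using D.rcos_eq_self_iff[OF \<pi>.hom_closed[OF assms]]
  by (simp add: abelian_image_def abelianisation_def abelianisation_proj_def)

lemma commutator_subgroup_presented_group:
  "commutator_subgroup (presented_group X R) =
    presentation_proj X R ` kernel (free_group X) (presented_abelianisation X R) (abelian_image X R)"
  (is "?D = ?p ` ?K")
proof
  show "?D \<subseteq> ?p ` ?K"
  proof
    fix g assume g: "g \<in> ?D"
    then obtain w where w: "w \<in> carrier (free_group X)" "g = ?p w"
      using D.mem_carrier[OF g] presentation_proj_surj[OF R] by blast
    then have "w \<in> ?K" using g abelian_image_eq_one_iff[OF w(1)] by (simp add: kernel_def)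
    then show "g \<in> ?p ` ?K" using w by blast
  qed
  show "?p ` ?K \<subseteq> ?D" using abelian_image_eq_one_iff by (auto simp: kernel_def)
qed

text \<open>This describes the kernel of the projection to the abelianisation inside the free group, and lets
  bounds on it be found without the intermediate quotient. A subgroup with all commutators is normal, so
  it contains the consequences of \<open>R\<close>, and its image contains the commutator subgroup.\<close>

lemma abelian_image_kernel_minimal:
  assumes L: "subgroup L (free_group X)" and RL: "R \<subseteq> L"
    and comm: "\<And>v w. v \<in> carrier (free_group X) \<Longrightarrow> w \<in> carrier (free_group X) \<Longrightarrow>
      v \<otimes>\<^bsub>free_group X\<^esub> w \<otimes>\<^bsub>free_group X\<^esub> inv\<^bsub>free_group X\<^esub> v \<otimes>\<^bsub>free_group X\<^esub> inv\<^bsub>free_group X\<^esub> w \<in> L"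
    and w: "w \<in> carrier (free_group X)"
    and one: "abelian_image X R w = \<one>\<^bsub>presented_abelianisation X R\<^esub>"
  shows "w \<in> L"
proof -
  interpret L: subgroup L "free_group X" by fact
  have "L \<lhd> free_group X"
  proof (rule F.normal_invI[OF L])
    fix x h assume x: "x \<in> carrier (free_group X)" and h: "h \<in> L"
    have "x \<otimes>\<^bsub>free_group X\<^esub> h \<otimes>\<^bsub>free_group X\<^esub> inv\<^bsub>free_group X\<^esub> x \<otimes>\<^bsub>free_group X\<^esub> inv\<^bsub>free_group X\<^esub> h \<otimes>\<^bsub>free_group X\<^esub> h \<in> L"
      using comm[OF x] h by simp
    then show "x \<otimes>\<^bsub>free_group X\<^esub> h \<otimes>\<^bsub>free_group X\<^esub> inv\<^bsub>free_group X\<^esub> x \<in> L"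
      using x h by (simp add: F.m_assoc)
  qed
  then have NL: "normal_closure (free_group X) R \<subseteq> L" using RL by (rule normal_closure_minimal)
  have "commutator_subgroup (presented_group X R) \<subseteq> presentation_proj X R ` L"
    unfolding derived_def
  proof (rule G.generate_subgroup_incl[OF _ \<pi>.subgroup_img_is_subgroup[OF L]])
    show "derived_set (presented_group X R) (carrier (presented_group X R)) \<subseteq> presentation_proj X R ` L"
    proof (clarsimp simp flip: presentation_proj_surj[OF R])
      fix v w assume vw: "v \<in> carrier (free_group X)" "w \<in> carrier (free_group X)"
      let ?p = "presentation_proj X R"
      have "?p v \<otimes>\<^bsub>presented_group X R\<^esub> ?p w \<otimes>\<^bsub>presented_group X R\<^esub> inv\<^bsub>presented_group X R\<^esub> ?p v
          \<otimes>\<^bsub>presented_group X R\<^esub> inv\<^bsub>presented_group X R\<^esub> ?p w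
        = ?p (v \<otimes>\<^bsub>free_group X\<^esub> w \<otimes>\<^bsub>free_group X\<^esub> inv\<^bsub>free_group X\<^esub> v \<otimes>\<^bsub>free_group X\<^esub> inv\<^bsub>free_group X\<^esub> w)"
        using vw by simp
      then show "?p v \<otimes>\<^bsub>presented_group X R\<^esub> ?p w \<otimes>\<^bsub>presented_group X R\<^esub> inv\<^bsub>presented_group X R\<^esub> ?p v
          \<otimes>\<^bsub>presented_group X R\<^esub> inv\<^bsub>presented_group X R\<^esub> ?p w \<in> ?p ` L"
        using comm[OF vw] by (metis imageI)
    qed
  qed
  then obtain l where l: "l \<in> L" "presentation_proj X R w = presentation_proj X R l"
    using one w by (auto simp: abelian_image_eq_one_iff)
  then have "presentation_proj X R (w \<otimes>\<^bsub>free_group X\<^esub> inv\<^bsub>free_group X\<^esub> l) = \<one>\<^bsub>presented_group X R\<^esub>"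
    using w by simp
  then have "w \<otimes>\<^bsub>free_group X\<^esub> inv\<^bsub>free_group X\<^esub> l \<in> normal_closure (free_group X) R"
    using w l by (subst (asm) presentation_proj_eq_one_iff[OF R]) simp_all
  then have "w \<otimes>\<^bsub>free_group X\<^esub> inv\<^bsub>free_group X\<^esub> l \<otimes>\<^bsub>free_group X\<^esub> l \<in> L"
    using NL l by blast
  then show ?thesis using w l by (simp add: F.m_assoc)
qed

end

lemma abelian_image_factors:
  assumes R: "R \<subseteq> carrier (free_group X)" and B: "comm_group B" and f: "f \<in> hom (free_group X) B"
    and fR: "\<And>w. w \<in> R \<Longrightarrow> f w = \<one>\<^bsub>B\<^esub>" and w: "w \<in> carrier (free_group X)"
    and one: "abelian_image X R w = \<one>\<^bsub>presented_abelianisation X R\<^esub>"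
  shows "f w = \<one>\<^bsub>B\<^esub>"
proof -
  interpret B: comm_group B by fact
  interpret f: group_hom "free_group X" B f
    using f by (simp add: group_hom_def group_hom_axioms_def group_free_group B.is_group)
  have "w \<in> kernel (free_group X) B f"
  proof (rule abelian_image_kernel_minimal[OF R f.subgroup_kernel _ _ w one])
    show "R \<subseteq> kernel (free_group X) B f" using R fR by (auto simp: kernel_def)
    fix v w assume vw: "v \<in> carrier (free_group X)" "w \<in> carrier (free_group X)"
    then have "f v \<otimes>\<^bsub>B\<^esub> f w \<otimes>\<^bsub>B\<^esub> inv\<^bsub>B\<^esub> f v \<otimes>\<^bsub>B\<^esub> inv\<^bsub>B\<^esub> f w = \<one>\<^bsub>B\<^esub>"
      by (simp add: B.m_comm[of "f v" "f w"] B.m_assoc)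
    then show "v \<otimes>\<^bsub>free_group X\<^esub> w \<otimes>\<^bsub>free_group X\<^esub> inv\<^bsub>free_group X\<^esub> v \<otimes>\<^bsub>free_group X\<^esub> inv\<^bsub>free_group X\<^esub> w
        \<in> kernel (free_group X) B f"
      using vw by (simp add: kernel_def)
  qed
  then show ?thesis by (simp add: kernel_def)
qed

lemma abelian_image_relator:
  assumes R: "R \<subseteq> carrier (free_group X)" and w: "w \<in> R"
  shows "abelian_image X R w = \<one>\<^bsub>presented_abelianisation X R\<^esub>"
proof -
  interpret F: group "free_group X" by (rule group_free_group)
  interpret G: group "presented_group X R" using R by (rule group_presented_group)
  have "presentation_proj X R w = \<one>\<^bsub>presented_group X R\<^esub>"
    using R w F.subset_normal_closure[OF R] presentation_proj_eq_one_iff[OF R, of w] by blast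
  moreover have "\<one>\<^bsub>presented_group X R\<^esub> \<in> commutator_subgroup (presented_group X R)"
    using G.derived_self_is_normal normal_imp_subgroup subgroup.one_closed by blast
  ultimately show ?thesis using R w abelian_image_eq_one_iff[OF R, of w] by auto
qed

section \<open>Orders of roots of relators\<close>

text \<open>Let \<open>a\<close> be the image of \<open>u\<close> in the abelianisation \<open>B\<close> of \<open>\<langle>X | S\<rangle>\<close>. The finite abelianisation is
  \<open>B\<close> modulo the powers of \<open>a ^ m\<close>, so if \<open>a\<close> had finite order then \<open>B\<close> would be finite. Hence
  \<open>a\<close> has infinite order, and \<open>a ^ n\<close> can be a power of \<open>a ^ m\<close> only if \<open>m\<close> divides \<open>n\<close>;
  this holds for the order \<open>n > 0\<close> of \<open>u\<close> in the finite abelianisation.\<close>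

lemma ord_abelian_image_ge:
  fixes m :: nat
  assumes S: "S \<subseteq> carrier (free_group X)" and u: "u \<in> carrier (free_group X)"
    and R: "R = insert (u [^]\<^bsub>free_group X\<^esub> m) S"
    and inf: "infinite (carrier (presented_abelianisation X S))"
    and fin: "finite (carrier (presented_abelianisation X R))"
  shows "m \<le> group.ord (presented_abelianisation X R) (abelian_image X R u)"
proof (rule ccontr)
  define Q where "Q = presented_abelianisation X R"
  define B where "B = presented_abelianisation X S"
  define \<rho> where "\<rho> = abelian_image X R"
  define \<beta> where "\<beta> = abelian_image X S"
  interpret F: group "free_group X" by (rule group_free_group)
  have R_sub: "R \<subseteq> carrier (free_group X)" using S u R by simp
  interpret Q: comm_group Q unfolding Q_def by (rule comm_group_presented_abelianisation[OF R_sub])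
  interpret B: comm_group B unfolding B_def by (rule comm_group_presented_abelianisation[OF S])
  interpret \<rho>: group_hom "free_group X" Q \<rho>
    using abelian_image_hom[OF R_sub] by unfold_locales (simp add: Q_def \<rho>_def)
  interpret \<beta>: group_hom "free_group X" B \<beta>
    using abelian_image_hom[OF S] by unfold_locales (simp add: B_def \<beta>_def)
  define a where "a = \<beta> u"
  have a: "a \<in> carrier B" using u by (simp add: a_def)
  \<comment> \<open>the preimage of the subgroup generated by \<open>a ^ m\<close>, which turns out to contain the kernel of \<open>\<rho>\<close>\<close>
  define L where "L = {w \<in> carrier (free_group X). \<exists>s::int. \<beta> w = a [^]\<^bsub>B\<^esub> (int m * s)}"
  have mem_L: "w \<in> L" if "w \<in> carrier (free_group X)" "\<beta> w = a [^]\<^bsub>B\<^esub> (int m * s)" for w s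
    using that by (auto simp: L_def)
  have L: "w \<in> L" if w: "w \<in> carrier (free_group X)" and "\<rho> w = \<one>\<^bsub>Q\<^esub>" for w
  proof (rule abelian_image_kernel_minimal[OF R_sub _ _ _ w])
    show "abelian_image X R w = \<one>\<^bsub>presented_abelianisation X R\<^esub>"
      using that by (simp add: \<rho>_def Q_def)
    have one: "v \<in> L" if "v \<in> carrier (free_group X)" "\<beta> v = \<one>\<^bsub>B\<^esub>" for v
      using that by (intro mem_L[of _ 0]) simp_all
    show "subgroup L (free_group X)"
    proof (rule F.subgroupI)
      show "L \<noteq> {}" using one[OF F.one_closed] by auto
      show "inv\<^bsub>free_group X\<^esub> v \<in> L" if v: "v \<in> L" for v
      proof -
        obtain s where "\<beta> v = a [^]\<^bsub>B\<^esub> (int m * s)" using v by (auto simp: L_def)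
        then have eq: "\<beta> (inv\<^bsub>free_group X\<^esub> v) = a [^]\<^bsub>B\<^esub> (int m * (- s))"
          using v a by (simp add: L_def B.int_pow_neg)
        show ?thesis by (rule mem_L[OF _ eq]) (use v in \<open>simp add: L_def\<close>)
      qed
      show "v \<otimes>\<^bsub>free_group X\<^esub> w \<in> L" if vw: "v \<in> L" "w \<in> L" for v w
      proof -
        obtain s s' where "\<beta> v = a [^]\<^bsub>B\<^esub> (int m * s)" "\<beta> w = a [^]\<^bsub>B\<^esub> (int m * s')"
          using vw by (auto simp: L_def)
        then have eq: "\<beta> (v \<otimes>\<^bsub>free_group X\<^esub> w) = a [^]\<^bsub>B\<^esub> (int m * (s + s'))"
          using vw a by (simp add: L_def B.int_pow_mult distrib_left)
        show ?thesis by (rule mem_L[OF _ eq]) (use vw in \<open>simp add: L_def\<close>)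
      qed
    qed (auto simp: L_def)
    show "R \<subseteq> L"
    proof
      fix w assume "w \<in> R"
      then consider "w = u [^]\<^bsub>free_group X\<^esub> m" | "w \<in> S" using R by blast
      then show "w \<in> L"
      proof cases
        case 1
        then have eq: "\<beta> w = a [^]\<^bsub>B\<^esub> (int m * 1)" using u by (simp add: \<beta>.hom_nat_pow a_def int_pow_int)
        show ?thesis by (rule mem_L[OF _ eq]) (use 1 u in simp)
      next
        case 2
        then show ?thesis using S abelian_image_relator[OF S] by (intro one) (auto simp: \<beta>_def B_def)
      qed
    qed
    fix v w assume vw: "v \<in> carrier (free_group X)" "w \<in> carrier (free_group X)"
    then have "\<beta> v \<otimes>\<^bsub>B\<^esub> \<beta> w \<otimes>\<^bsub>B\<^esub> inv\<^bsub>B\<^esub> \<beta> v \<otimes>\<^bsub>B\<^esub> inv\<^bsub>B\<^esub> \<beta> w = \<one>\<^bsub>B\<^esub>"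
      by (simp add: B.m_comm[of "\<beta> v" "\<beta> w"] B.m_assoc)
    then show "v \<otimes>\<^bsub>free_group X\<^esub> w \<otimes>\<^bsub>free_group X\<^esub> inv\<^bsub>free_group X\<^esub> v \<otimes>\<^bsub>free_group X\<^esub> inv\<^bsub>free_group X\<^esub> w \<in> L"
      using vw by (intro one) simp_all
  qed
  have finQ: "finite (carrier Q)" using fin by (simp add: Q_def)
  define n where "n = Q.ord (\<rho> u)"
  have n: "n > 0" using Q.ord_ge_1[OF finQ \<rho>.hom_closed[OF u]] by (simp add: n_def)
  assume "\<not> m \<le> group.ord (presented_abelianisation X R) (abelian_image X R u)"
  then have nm: "n < m" by (simp add: n_def Q_def \<rho>_def)
  have "\<rho> (u [^]\<^bsub>free_group X\<^esub> n) = \<one>\<^bsub>Q\<^esub>" using u by (simp add: \<rho>.hom_nat_pow n_def)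
  then obtain s where "\<beta> (u [^]\<^bsub>free_group X\<^esub> n) = a [^]\<^bsub>B\<^esub> (int m * s)"
    using L[of "u [^]\<^bsub>free_group X\<^esub> n"] u by (auto simp: L_def)
  then have "a [^]\<^bsub>B\<^esub> (int n) = a [^]\<^bsub>B\<^esub> (int m * s)"
    using u by (simp add: \<beta>.hom_nat_pow a_def int_pow_int)
  then have "int (B.ord a) dvd int n - int m * s"
    using a B.int_pow_eq by (simp add: dvd_diff_commute)
  moreover have "int n - int m * s \<noteq> 0"
  proof
    assume "int n - int m * s = 0"
    then have "int m dvd int n" by simp
    then show False using n nm by (simp add: nat_dvd_not_less)
  qed
  ultimately have "B.ord a \<noteq> 0" by (metis dvd_0_left_iff of_nat_0)
  then have finA: "finite (generate B {a})"
    unfolding B.generate_pow_card[OF a] by (rule card_ge_0_finite[OF neq0_conv[THEN iffD1]])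
  \<comment> \<open>Up to the finite subgroup generated by \<open>a\<close>, every element of \<open>B\<close> comes from a representative
    of one of the finitely many elements of \<open>Q\<close>.\<close>
  define \<sigma> where "\<sigma> q = (SOME w. w \<in> carrier (free_group X) \<and> \<rho> w = q)" for q
  have \<sigma>: "\<sigma> q \<in> carrier (free_group X) \<and> \<rho> (\<sigma> q) = q" if "q \<in> carrier Q" for q
  proof -
    have "q \<in> \<rho> ` carrier (free_group X)"
      using that abelian_image_surj[OF R_sub] by (simp add: Q_def \<rho>_def)
    then have "\<exists>w. w \<in> carrier (free_group X) \<and> \<rho> w = q" by blast
    then show ?thesis unfolding \<sigma>_def by (rule someI_ex)
  qed
  have "carrier B \<subseteq> (\<lambda>(q, p). \<beta> (\<sigma> q) \<otimes>\<^bsub>B\<^esub> p) ` (carrier Q \<times> generate B {a})"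
  proof
    fix b assume "b \<in> carrier B"
    then obtain w where w: "w \<in> carrier (free_group X)" "b = \<beta> w"
      using abelian_image_surj[OF S] by (auto simp: B_def \<beta>_def)
    define v where "v = \<sigma> (\<rho> w)"
    have v: "v \<in> carrier (free_group X)" "\<rho> v = \<rho> w" using \<sigma>[of "\<rho> w"] w by (simp_all add: v_def)
    have "inv\<^bsub>free_group X\<^esub> v \<otimes>\<^bsub>free_group X\<^esub> w \<in> L" using v w by (intro L) simp_all
    then obtain s where s: "\<beta> (inv\<^bsub>free_group X\<^esub> v \<otimes>\<^bsub>free_group X\<^esub> w) = a [^]\<^bsub>B\<^esub> (int m * s)"
      by (auto simp: L_def)
    have "b = \<beta> v \<otimes>\<^bsub>B\<^esub> \<beta> (inv\<^bsub>free_group X\<^esub> v \<otimes>\<^bsub>free_group X\<^esub> w)"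
      using v w by (simp add: B.m_assoc[symmetric])
    moreover have "a [^]\<^bsub>B\<^esub> (int m * s) \<in> generate B {a}" using B.generate_pow[OF a] by blast
    ultimately show "b \<in> (\<lambda>(q, p). \<beta> (\<sigma> q) \<otimes>\<^bsub>B\<^esub> p) ` (carrier Q \<times> generate B {a})"
      using w s by (force simp: v_def)
  qed
  then have "finite (carrier B)" by (rule finite_subset) (use finA finQ in simp)
  then show False using inf by (simp add: B_def)
qed

section \<open>Fewer relators than generators\<close>

text \<open>Gaussian elimination: one equation is solved for one unknown \<open>x0\<close>, and the others are replaced by
  equations \<open>a'\<close> that do not involve it.\<close>

lemma homogeneous_system_nontrivial_solution:
  fixes a :: "'e \<Rightarrow> 'x \<Rightarrow> 'f::field"
  assumes "finite E" "finite X" "card E < card X"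
  shows "\<exists>c. (\<exists>x\<in>X. c x \<noteq> 0) \<and> (\<forall>e\<in>E. (\<Sum>x\<in>X. a e x * c x) = 0)"
  using assms
proof (induction E arbitrary: X a rule: finite_induct)
  case empty
  then show ?case by (intro exI[of _ "\<lambda>_. 1"]) (auto simp: card_gt_0_iff)
next
  case (insert e E)
  show ?case
  proof (cases "\<forall>x\<in>X. a e x = 0")
    case True
    then show ?thesis using insert.IH[of X a] insert.prems insert.hyps by auto
  next
    case False
    then obtain x0 where x0: "x0 \<in> X" "a e x0 \<noteq> 0" by blast
    define a' where "a' e' x = a e' x - a e' x0 / a e x0 * a e x" for e' x
    have "card E < card (X - {x0})" using insert x0 by simp
    then obtain c where c: "\<exists>x\<in>X - {x0}. c x \<noteq> 0"
      "\<And>e'. e' \<in> E \<Longrightarrow> (\<Sum>x\<in>X - {x0}. a' e' x * c x) = 0"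
      using insert.IH[of "X - {x0}" a'] insert.prems by auto
    define s where "s = (\<Sum>x\<in>X - {x0}. a e x * c x)"
    define c' where "c' = c(x0 := - s / a e x0)"
    have split: "(\<Sum>x\<in>X. a e' x * c' x) = (\<Sum>x\<in>X - {x0}. a e' x * c x) - a e' x0 / a e x0 * s" for e'
    proof -
      have "(\<Sum>x\<in>X. a e' x * c' x) = a e' x0 * c' x0 + (\<Sum>x\<in>X - {x0}. a e' x * c' x)"
        using insert.prems x0 by (intro sum.remove) auto
      also have "(\<Sum>x\<in>X - {x0}. a e' x * c' x) = (\<Sum>x\<in>X - {x0}. a e' x * c x)"
        by (rule sum.cong) (auto simp: c'_def)
      finally show ?thesis by (simp add: c'_def)
    qed
    have "(\<Sum>x\<in>X. a e' x * c' x) = 0" if "e' \<in> E" for e'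
    proof -
      have "0 = (\<Sum>x\<in>X - {x0}. a e' x * c x - a e' x0 / a e x0 * (a e x * c x))"
        using c(2)[OF that] by (simp add: a'_def algebra_simps)
      also have "\<dots> = (\<Sum>x\<in>X - {x0}. a e' x * c x) - a e' x0 / a e x0 * s"
        by (simp add: sum_subtractf s_def sum_distrib_left)
      finally show ?thesis by (simp add: split)
    qed
    moreover have "(\<Sum>x\<in>X. a e x * c' x) = 0" using x0 by (simp add: split) (simp add: s_def)
    moreover have "\<exists>x\<in>X. c' x \<noteq> 0" using c(1) by (auto simp: c'_def)
    ultimately show ?thesis by blast
  qed
qed

definition exponent_sum :: "'x \<Rightarrow> 'x word \<Rightarrow> real" where
  "exponent_sum x w = (\<Sum>(y, b)\<leftarrow>w. if y = x then if b then 1 else - 1 else 0)"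

lemma exponent_sum_mult:
  assumes "w \<in> carrier (free_group X)"
  shows "exponent_sum x (v \<otimes>\<^bsub>free_group X\<^esub> w) = exponent_sum x v + exponent_sum x w"
proof -
  have "exponent_sum x (cons_reduce a w) = exponent_sum x [a] + exponent_sum x w" for a w
    by (cases w; cases a) (auto simp: exponent_sum_def)
  then have "exponent_sum x (foldr cons_reduce v w) = exponent_sum x v + exponent_sum x w"
    by (induction v) (simp_all add: exponent_sum_def)
  then show ?thesis using assms by (simp add: mult_free_group)
qed

text \<open>A nontrivial solution \<open>c\<close> of the linear equations given by the exponent sums of the relators defines a
  homomorphism to the additive group of the reals that kills the relators but not every generator. Its
  image is a quotient of the abelianisation, and it is infinite since it is nonzero and torsion-free.\<close>

lemma infinite_presented_abelianisation:
  assumes X: "finite X" and R: "R \<subseteq> carrier (free_group X)" "finite R" and card: "card R < card X"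
  shows "infinite (carrier (presented_abelianisation X R))"
proof
  assume fin: "finite (carrier (presented_abelianisation X R))"
  define Q where "Q = presented_abelianisation X R"
  define \<rho> where "\<rho> = abelian_image X R"
  interpret F: group "free_group X" by (rule group_free_group)
  interpret Q: comm_group Q unfolding Q_def by (rule comm_group_presented_abelianisation[OF R(1)])
  interpret \<rho>: group_hom "free_group X" Q \<rho>
    using abelian_image_hom[OF R(1)] by unfold_locales (simp add: Q_def \<rho>_def)
  obtain c where c: "\<exists>x\<in>X. c x \<noteq> 0" "\<And>w. w \<in> R \<Longrightarrow> (\<Sum>x\<in>X. exponent_sum x w * c x) = 0"
    using homogeneous_system_nontrivial_solution[OF R(2) X card, of "\<lambda>w x. exponent_sum x w"] by blast
  define f where "f w = (\<Sum>x\<in>X. exponent_sum x w * c x)" for w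
  have f_mult: "f (v \<otimes>\<^bsub>free_group X\<^esub> w) = f v + f w" if "w \<in> carrier (free_group X)" for v w
    using that by (simp add: f_def exponent_sum_mult distrib_right sum.distrib)
  have f_one: "f \<one>\<^bsub>free_group X\<^esub> = 0" by (simp add: f_def exponent_sum_def one_free_group)
  have f_inv: "f (inv\<^bsub>free_group X\<^esub> w) = - f w" if "w \<in> carrier (free_group X)" for w
    using f_mult[OF that, of "inv\<^bsub>free_group X\<^esub> w"] that f_one by simp
  have f_pow: "f (w [^]\<^bsub>free_group X\<^esub> n) = real n * f w" if "w \<in> carrier (free_group X)" for w and n :: nat
    using that by (induction n) (simp_all add: f_one f_mult algebra_simps)
  have f_ker: "f w = 0" if w: "w \<in> carrier (free_group X)" and "\<rho> w = \<one>\<^bsub>Q\<^esub>" for w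
  proof -
    define L where "L = {w \<in> carrier (free_group X). f w = 0}"
    have "w \<in> L"
    proof (rule abelian_image_kernel_minimal[OF R(1) _ _ _ w])
      show "subgroup L (free_group X)"
        by (rule F.subgroupI) (use f_one in \<open>auto simp: L_def f_inv f_mult\<close>)
      show "R \<subseteq> L" using R(1) c(2) by (auto simp: L_def f_def)
      show "abelian_image X R w = \<one>\<^bsub>presented_abelianisation X R\<^esub>"
        using that by (simp add: \<rho>_def Q_def)
    qed (simp add: L_def f_mult f_inv)
    then show ?thesis by (simp add: L_def)
  qed
  obtain x where x: "x \<in> X" "c x \<noteq> 0" using c(1) by blast
  let ?w = "[(x, True)]"
  have w: "?w \<in> carrier (free_group X)" using x by (simp add: letter_in_free_group)
  have "f ?w = (\<Sum>y\<in>X. if y = x then c x else 0)"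
    unfolding f_def by (rule sum.cong) (auto simp: exponent_sum_def)
  then have "f ?w = c x" using X x by simp
  moreover have "f (?w [^]\<^bsub>free_group X\<^esub> order Q) = 0"
    using w by (intro f_ker) (simp_all add: \<rho>.hom_nat_pow Q.pow_order_eq_1)
  ultimately have "real (order Q) * c x = 0" using w by (simp add: f_pow)
  moreover have "order Q > 0" using Q.order_gt_0_iff_finite fin by (simp add: Q_def)
  ultimately show False using x by simp
qed

section \<open>Deficiency of the commutator subgroup\<close>

theorem theorem2p4:
  fixes d :: nat
    and u :: "nat \<Rightarrow> nat word"
    and m :: "nat \<Rightarrow> nat"
    and I J :: "nat set"
    and l :: nat
    and r :: "nat \<Rightarrow> nat word"
    and G :: "nat word set monoid"
    and H :: "nat \<Rightarrow> nat word set monoid"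
  assumes d: "d \<ge> 2"
    and I_def: "I = {1..d + 1}"
    and u: "\<And>i. i \<in> I \<Longrightarrow> u i \<in> carrier (free_group {1..d})"
    and m: "\<And>i. i \<in> I \<Longrightarrow> m i \<ge> 1"
    and r_def: "\<And>i. i \<in> I \<Longrightarrow> r i = u i [^]\<^bsub>free_group {1..d}\<^esub> m i"
    and G_def: "G = presented_group {1..d} (r ` I)"
    and H_def: "\<And>i. i \<in> I \<Longrightarrow> H i = presented_group {1..d} (r ` (I - {i}))"
    and J_def: "J = {j \<in> I. finite (carrier (abelianisation (H j)))}"
    and l_def: "l = card J"
    and finite_ab: "finite (carrier (abelianisation G))"
    and nontrivial_ab: "carrier (abelianisation G) \<noteq> {\<one>\<^bsub>abelianisation G\<^esub>}"
  shows "(real d - real l - (\<Sum>i\<in>I - J. 1 / real (m i)) > 1 \<longrightarrow>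
            deficiency (commutator_group G) > 1)
       \<and> (\<forall>j\<in>J. \<forall>k.
            presentation_proj {1..d} (r ` (I - {j})) (r j) \<in> commutator_subgroup (H j) \<longrightarrow>
            k = group.ord (abelianisation (H j))
                  (abelianisation_proj (H j) (presentation_proj {1..d} (r ` (I - {j})) (u j))) \<longrightarrow>
            real d - (\<Sum>i\<in>I - {j}. 1 / real (m i)) - 1 / real k > 1 \<longrightarrow>
            deficiency (commutator_group G) > 1)"
proof -
  define X where "X = {1..d}"
  define F where "F = free_group X"
  interpret F: group F unfolding F_def by (rule group_free_group)
  have uF: "u i \<in> carrier F" if "i \<in> I" for i using that u by (simp add: F_def X_def)
  have r_eq_pow: "r i = u i [^]\<^bsub>F\<^esub> m i" if "i \<in> I" for i using that r_def by (simp add: F_def X_def)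
  have r_F: "r i \<in> carrier F" if "i \<in> I" for i
    using uF[OF that] by (simp add: r_eq_pow[OF that])
  have r_sub: "r ` K \<subseteq> carrier (free_group X)" if "K \<subseteq> I" for K
    using that r_F by (auto simp: F_def)
  have r_insert: "r ` K = insert (u i [^]\<^bsub>free_group X\<^esub> m i) (r ` (K - {i}))"
    if "i \<in> K" "K \<subseteq> I" for i K
  proof -
    have "r ` K = insert (r i) (r ` (K - {i}))" using \<open>i \<in> K\<close> by (metis image_insert insert_Diff)
    then show ?thesis using that r_eq_pow[of i] by (auto simp: F_def)
  qed
  have finI: "finite I" by (simp add: I_def)
  define Q where "Q = presented_abelianisation X (r ` I)"
  define \<rho> where "\<rho> = abelian_image X (r ` I)"
  interpret Q: comm_group Q
    unfolding Q_def by (rule comm_group_presented_abelianisation[OF r_sub[OF order_refl]])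
  interpret \<rho>: group_hom F Q \<rho>
    using abelian_image_hom[OF r_sub[OF order_refl]] by unfold_locales (simp add: Q_def \<rho>_def F_def)
  have fin: "finite (carrier Q)" using finite_ab by (simp add: Q_def G_def X_def)
  define ord_u where "ord_u i = Q.ord (\<rho> (u i))" for i
  have ord_u_pos: "ord_u i \<ge> 1" if "i \<in> I" for i
    using Q.ord_ge_1[OF fin] uF[OF that] by (simp add: ord_u_def)
  have r_eq: "r ` I = (\<lambda>i. u i [^]\<^bsub>F\<^esub> m i) ` I"
    using r_eq_pow by simp
  have "ereal (1 + real (order Q) * (real d - 1 - (\<Sum>i\<in>I. 1 / real (ord_u i))))
      \<le> deficiency (presented_group X (r ` I)
          \<lparr>carrier := presentation_proj X (r ` I) ` kernel F Q \<rho>\<rparr>)"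
    unfolding r_eq ord_u_def F_def X_def
  proof (rule deficiency_kernel_ge[OF Q.is_group fin _ _ finI u])
    show "\<rho> \<in> hom (free_group {1..d}) Q" using \<rho>.homh by (simp add: F_def X_def)
    show "\<rho> ` carrier (free_group {1..d}) = carrier Q"
      using abelian_image_surj[OF r_sub[OF order_refl]] by (simp add: \<rho>_def Q_def X_def)
    show "\<rho> (u i [^]\<^bsub>free_group {1..d}\<^esub> m i) = \<one>\<^bsub>Q\<^esub>" if "i \<in> I" for i
      using abelian_image_relator[OF r_sub[OF order_refl], of "r i"] that
      by (simp add: \<rho>_def Q_def r_def)
  qed
  also have "presented_group X (r ` I)\<lparr>carrier := presentation_proj X (r ` I) ` kernel F Q \<rho>\<rparr>
      = commutator_group G"
    unfolding commutator_group_def G_def X_def[symmetric]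
      commutator_subgroup_presented_group[OF r_sub[OF order_refl]]
    by (simp add: F_def Q_def \<rho>_def)
  finally have def_ge: "ereal (1 + real (order Q) * (real d - 1 - (\<Sum>i\<in>I. 1 / real (ord_u i))))
      \<le> deficiency (commutator_group G)" .
  have ordQ: "real (order Q) > 0" using Q.order_gt_0_iff_finite fin by simp
  \<comment> \<open>The order of \<open>Q\<close> is a positive factor and does not influence the sign of the excess over one.\<close>
  have def_gt: "deficiency (commutator_group G) > 1"
    if s: "(\<Sum>i\<in>I. 1 / real (ord_u i)) \<le> s" "real d - s > 1" for s
  proof -
    have "1 < 1 + real (order Q) * (real d - 1 - (\<Sum>i\<in>I. 1 / real (ord_u i)))"
      using s ordQ by simp
    then have "1 < ereal (1 + real (order Q) * (real d - 1 - (\<Sum>i\<in>I. 1 / real (ord_u i))))"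
      by (simp add: one_ereal_def)
    then show ?thesis using def_ge by (rule less_le_trans)
  qed
  show ?thesis
  proof (intro conjI allI impI ballI)
    assume bound: "real d - real l - (\<Sum>i\<in>I - J. 1 / real (m i)) > 1"
    have o_ge: "ord_u i \<ge> m i" if i: "i \<in> I - J" for i
      unfolding ord_u_def \<rho>_def Q_def
    proof (rule ord_abelian_image_ge[of "r ` (I - {i})"])
      show "r ` I = insert (u i [^]\<^bsub>free_group X\<^esub> m i) (r ` (I - {i}))"
        using i by (intro r_insert) auto
      show "infinite (carrier (presented_abelianisation X (r ` (I - {i}))))"
        using i by (simp add: J_def H_def X_def)
      show "finite (carrier (presented_abelianisation X (r ` I)))" using fin by (simp add: Q_def)
    qed (use i r_sub uF in \<open>auto simp: F_def\<close>)
    have J: "J \<subseteq> I" by (auto simp: J_def)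
    have "(\<Sum>i\<in>I. 1 / real (ord_u i)) = (\<Sum>i\<in>J. 1 / real (ord_u i)) + (\<Sum>i\<in>I - J. 1 / real (ord_u i))"
      using sum.subset_diff[OF J finI] by (simp add: add.commute)
    also have "\<dots> \<le> (\<Sum>i\<in>J. 1) + (\<Sum>i\<in>I - J. 1 / real (m i))"
    proof (intro add_mono sum_mono)
      show "1 / real (ord_u i) \<le> 1" if "i \<in> J" for i using that J ord_u_pos[of i] by auto
      show "1 / real (ord_u i) \<le> 1 / real (m i)" if "i \<in> I - J" for i
        using that o_ge[of i] m[of i] by (intro divide_left_mono) auto
    qed
    finally have "(\<Sum>i\<in>I. 1 / real (ord_u i)) \<le> real l + (\<Sum>i\<in>I - J. 1 / real (m i))"
      by (simp add: l_def)
    then show "deficiency (commutator_group G) > 1" by (rule def_gt) (use bound in simp)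
  next
    fix j k
    assume j: "j \<in> J"
      and rj: "presentation_proj {1..d} (r ` (I - {j})) (r j) \<in> commutator_subgroup (H j)"
      and k: "k = group.ord (abelianisation (H j))
                  (abelianisation_proj (H j) (presentation_proj {1..d} (r ` (I - {j})) (u j)))"
      and bound: "real d - (\<Sum>i\<in>I - {j}. 1 / real (m i)) - 1 / real k > 1"
    have jI: "j \<in> I" using j by (simp add: J_def)
    define R where "R = r ` (I - {j})"
    have R: "R \<subseteq> carrier (free_group X)" unfolding R_def by (rule r_sub) auto
    define B where "B = presented_abelianisation X R"
    define \<beta> where "\<beta> = abelian_image X R"
    interpret B: comm_group B unfolding B_def by (rule comm_group_presented_abelianisation[OF R])
    interpret \<beta>: group_hom F B \<beta>
      using abelian_image_hom[OF R] by unfold_locales (simp add: B_def \<beta>_def F_def)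
    have Hj: "H j = presented_group X R" using jI by (simp add: H_def R_def X_def)
    have finB: "finite (carrier B)" using j Hj by (simp add: J_def B_def)
    have k': "k = B.ord (\<beta> (u j))"
      by (simp add: k Hj B_def \<beta>_def abelian_image_def X_def R_def)
    \<comment> \<open>By the hypothesis on \<open>j\<close> the abelianisation \<open>B\<close> of \<open>H j\<close> is a quotient of \<open>Q\<close>.\<close>
    have \<beta>_r: "\<beta> w = \<one>\<^bsub>B\<^esub>" if "w \<in> r ` I" for w
    proof -
      consider "w = r j" | "w \<in> R" using \<open>w \<in> r ` I\<close> by (auto simp: R_def)
      then show ?thesis
      proof cases
        case 1
        then show ?thesis
          using rj jI r_F abelian_image_eq_one_iff[OF R, of w] Hj by (simp add: \<beta>_def B_def R_def X_def F_def)
      next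
        case 2
        then show ?thesis using abelian_image_relator[OF R] by (simp add: \<beta>_def B_def)
      qed
    qed
    have ord_le: "B.ord (\<beta> (u i)) \<le> ord_u i" if i: "i \<in> I" for i
    proof -
      have pow: "u i [^]\<^bsub>F\<^esub> ord_u i \<in> carrier (free_group X)" using uF[OF i] by (simp flip: F_def)
      have "\<rho> (u i [^]\<^bsub>F\<^esub> ord_u i) = \<one>\<^bsub>Q\<^esub>"
        using uF[OF i] by (simp add: \<rho>.hom_nat_pow ord_u_def)
      then have "\<beta> (u i [^]\<^bsub>F\<^esub> ord_u i) = \<one>\<^bsub>B\<^esub>"
        using abelian_image_factors[OF r_sub[OF order_refl] B.comm_group_axioms \<beta>.homh[unfolded F_def] \<beta>_r pow]
        by (simp add: \<rho>_def Q_def)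
      then have "B.ord (\<beta> (u i)) dvd ord_u i"
        using uF[OF i] by (simp add: \<beta>.hom_nat_pow B.pow_eq_id)
      then show ?thesis using ord_u_pos[OF i] by (simp add: dvd_imp_le)
    qed
    have o_ge: "ord_u i \<ge> m i" if i: "i \<in> I - {j}" for i
    proof -
      let ?S = "r ` (I - {j} - {i})"
      have S: "?S \<subseteq> carrier (free_group X)" by (rule r_sub) auto
      have "card ?S \<le> card (I - {j} - {i})" by (rule card_image_le) (use finI in auto)
      also have "\<dots> < card X" using i jI finI d by (simp add: X_def) (simp add: I_def)
      finally have "infinite (carrier (presented_abelianisation X ?S))"
        using S finI by (intro infinite_presented_abelianisation) (auto simp: X_def)
      moreover have "R = insert (u i [^]\<^bsub>free_group X\<^esub> m i) ?S"
        unfolding R_def using i by (intro r_insert) auto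
      ultimately have "m i \<le> B.ord (\<beta> (u i))"
        using ord_abelian_image_ge[OF S, of "u i" R "m i"] i uF finB by (simp add: B_def \<beta>_def F_def)
      then show ?thesis using ord_le[of i] i by simp
    qed
    have "k \<ge> 1" using B.ord_ge_1[OF finB] uF[OF jI] by (simp add: k')
    have "(\<Sum>i\<in>I. 1 / real (ord_u i)) = 1 / real (ord_u j) + (\<Sum>i\<in>I - {j}. 1 / real (ord_u i))"
      using finI jI by (rule sum.remove)
    also have "\<dots> \<le> 1 / real k + (\<Sum>i\<in>I - {j}. 1 / real (m i))"
    proof (intro add_mono sum_mono)
      show "1 / real (ord_u j) \<le> 1 / real k"
        using ord_le[OF jI] \<open>k \<ge> 1\<close> k' by (intro divide_left_mono) auto
      show "1 / real (ord_u i) \<le> 1 / real (m i)" if "i \<in> I - {j}" for i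
        using that o_ge[of i] m[of i] by (intro divide_left_mono) auto
    qed
    finally show "deficiency (commutator_group G) > 1" by (rule def_gt) (use bound in simp)
  qed
qed

end
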